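(* Let $k$ be a commutative ring and let $A$ be an associative $k$-algebra, regarded as a Lie algebra via $[a,b]=ab-ba$. The antisymmetrization maps $$\varphi_n : A^{\otimes (n+1)}\to A^{\otimes (n+1)},\qquad \varphi_n(a_0, a_1, \ldots, a_n) = \sum_{\sigma \in S_n} (\mathrm{sgn}\,\sigma)\,(a_0, a_{\sigma^{-1}(1)}, \ldots, a_{\sigma^{-1}(n)}),\quad n\ge 0,$$ from $CL_{n+1}(A)$ to $CHH_n(A)$ induce a homomorphism, natural in $A$, $$\varphi_* : HL_{*+1}(A) \to HH_*(A)$$ from Leibniz homology to Hochschild homology.
   Context: Tensor products are over $k$; $(a_0,\ldots,a_n)$ denotes $a_0\otimes\cdots\otimes a_n$; $S_n$ is the symmetric group on $\{1,\ldots,n\}$. Leibniz homology $HL_*(A)$ is the homology of $CL_*(A)$: $CL_0(A)=k$, $CL_{n}(A)=A^{\otimes n}$ for $n\ge1$, with differential $0$ from $CL_1(A)=A$ to $k$ and, for $n\ge 1$, $d:A^{\otimes(n+1)}\to A^{\otimes n}$ given by $$d(a_0\otimes\cdots\otimes a_n)=\sum_{0\le i<j\le n}(-1)^{j+1}(a_0,\ldots,a_{i-1},[a_i,a_j],a_{i+1},\ldots,\widehat{a}_j,\ldots,a_n).$$ Hochschild homology $HH_*(A)$ is the homology of $CHH_*(A)$: $CHH_n(A)=A^{\otimes(n+1)}$, $n\ge0$, with $b=\sum_{i=0}^n(-1)^id_i$, where $d_i(a_0,\ldots,a_n)=(a_0,\ldots,a_ia_{i+1},\ldots,a_n)$ for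 $0\le i<n$ and $d_n(a_0,\ldots,a_n)=(a_na_0,a_1,\ldots,a_{n-1})$. *)

theory Defs
  imports "HOL-Algebra.Module" "HOL-Algebra.AbelCoset" "HOL-Combinatorics.Permutations"
begin

text \<open>
  Modules over a commutative ring \<open>R\<close> are the records of \<^theory>\<open>HOL-Algebra.Module\<close>. A record of
  type \<^typ>\<open>('k, 'a) module\<close> also has the fields \<open>mult\<close> and \<open>one\<close>, which the locale
  \<^locale>\<open>module\<close> ignores; modules constructed below leave them unspecified.
\<close>

section \<open>Linear maps, quotients and free modules\<close>

definition linear_map ::
  "('k, 'r) ring_scheme \<Rightarrow> ('k, 'a, 'm) module_scheme \<Rightarrow> ('k, 'b, 'n) module_scheme \<Rightarrow> ('a \<Rightarrow> 'b) \<Rightarrow> bool"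
  where "linear_map R M N h \<longleftrightarrow>
    module R M \<and> module R N \<and> h \<in> carrier M \<rightarrow> carrier N \<and>
    (\<forall>x\<in>carrier M. \<forall>y\<in>carrier M. h (x \<oplus>\<^bsub>M\<^esub> y) = h x \<oplus>\<^bsub>N\<^esub> h y) \<and>
    (\<forall>r\<in>carrier R. \<forall>x\<in>carrier M. h (r \<odot>\<^bsub>M\<^esub> x) = r \<odot>\<^bsub>N\<^esub> h x)"

definition submodule_span ::
  "('k, 'r) ring_scheme \<Rightarrow> ('k, 'a, 'm) module_scheme \<Rightarrow> 'a set \<Rightarrow> 'a set"
  where "submodule_span R M G = \<Inter>{N. submodule N R M \<and> G \<subseteq> N}"

definition quotient_module :: "('k, 'a, 'm) module_scheme \<Rightarrow> 'a set \<Rightarrow> ('k, 'a set) module"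
  where "quotient_module M N =
    \<lparr>carrier = a_rcosets\<^bsub>M\<^esub> N, monoid.mult = undefined, one = undefined,
     zero = N, add = set_add M, smult = (\<lambda>r X. \<Union>x\<in>X. N +>\<^bsub>M\<^esub> (r \<odot>\<^bsub>M\<^esub> x))\<rparr>"

definition free_module :: "('k, 'r) ring_scheme \<Rightarrow> 'x set \<Rightarrow> ('k, 'x \<Rightarrow> 'k) module"
  where "free_module R S =
    \<lparr>carrier = {f. f \<in> S \<rightarrow> carrier R \<and> (\<forall>x. x \<notin> S \<longrightarrow> f x = \<zero>\<^bsub>R\<^esub>) \<and> finite {x. f x \<noteq> \<zero>\<^bsub>R\<^esub>}},
     monoid.mult = undefined, one = undefined,
     zero = (\<lambda>x. \<zero>\<^bsub>R\<^esub>), add = (\<lambda>f g x. f x \<oplus>\<^bsub>R\<^esub> g x), smult = (\<lambda>r f x. r \<otimes>\<^bsub>R\<^esub> f x)\<rparr>"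

definition free_gen :: "('k, 'r) ring_scheme \<Rightarrow> 'x \<Rightarrow> 'x \<Rightarrow> 'k"
  where "free_gen R x = (\<lambda>y. if y = x then \<one>\<^bsub>R\<^esub> else \<zero>\<^bsub>R\<^esub>)"

section \<open>Tensor powers\<close>

text \<open>
  The tensor \<open>(a\<^sub>0, \<dots>, a\<^sub>n)\<close> is indexed by the list \<open>[a\<^sub>0, \<dots>, a\<^sub>n]\<close>. The power
  \<open>A\<^bsup>\<otimes>n\<^esup>\<close> is the free module on the lists of length \<open>n\<close> modulo multilinearity. For \<open>n = 0\<close> there
  are no relations and a single generator \<open>[]\<close>, so this is the ground ring \<open>R\<close>.
\<close>

definition tuples :: "('k, 'a, 'm) module_scheme \<Rightarrow> nat \<Rightarrow> 'a list set"
  where "tuples A n = {xs. length xs = n \<and> set xs \<subseteq> carrier A}"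

definition tensor_relations ::
  "('k, 'r) ring_scheme \<Rightarrow> ('k, 'a, 'm) module_scheme \<Rightarrow> nat \<Rightarrow> ('a list \<Rightarrow> 'k) set"
  where "tensor_relations R A n = (let F = free_module R (tuples A n); e = free_gen R in
    {e (xs[i := x \<oplus>\<^bsub>A\<^esub> y]) \<ominus>\<^bsub>F\<^esub> (e (xs[i := x]) \<oplus>\<^bsub>F\<^esub> e (xs[i := y])) | xs i x y.
       xs \<in> tuples A n \<and> i < n \<and> x \<in> carrier A \<and> y \<in> carrier A} \<union>
    {e (xs[i := r \<odot>\<^bsub>A\<^esub> x]) \<ominus>\<^bsub>F\<^esub> (r \<odot>\<^bsub>F\<^esub> e (xs[i := x])) | xs i r x.
       xs \<in> tuples A n \<and> i < n \<and> r \<in> carrier R \<and> x \<in> carrier A})"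

definition tensor_null ::
  "('k, 'r) ring_scheme \<Rightarrow> ('k, 'a, 'm) module_scheme \<Rightarrow> nat \<Rightarrow> ('a list \<Rightarrow> 'k) set"
  where "tensor_null R A n =
    submodule_span R (free_module R (tuples A n)) (tensor_relations R A n)"

definition tensor_power ::
  "('k, 'r) ring_scheme \<Rightarrow> ('k, 'a, 'm) module_scheme \<Rightarrow> nat \<Rightarrow> ('k, ('a list \<Rightarrow> 'k) set) module"
  where "tensor_power R A n = quotient_module (free_module R (tuples A n)) (tensor_null R A n)"

definition pure_tensor ::
  "('k, 'r) ring_scheme \<Rightarrow> ('k, 'a, 'm) module_scheme \<Rightarrow> 'a list \<Rightarrow> ('a list \<Rightarrow> 'k) set"
  where "pure_tensor R A xs =
    tensor_null R A (length xs) +>\<^bsub>free_module R (tuples A (length xs))\<^esub> free_gen R xs"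

definition multilinear ::
  "('k, 'r) ring_scheme \<Rightarrow> ('k, 'a, 'm) module_scheme \<Rightarrow> nat \<Rightarrow> ('k, 'b, 'n) module_scheme \<Rightarrow>
    ('a list \<Rightarrow> 'b) \<Rightarrow> bool"
  where "multilinear R A n M g \<longleftrightarrow>
    g \<in> tuples A n \<rightarrow> carrier M \<and>
    (\<forall>xs\<in>tuples A n. \<forall>i<n. \<forall>x\<in>carrier A. \<forall>y\<in>carrier A.
       g (xs[i := x \<oplus>\<^bsub>A\<^esub> y]) = g (xs[i := x]) \<oplus>\<^bsub>M\<^esub> g (xs[i := y])) \<and>
    (\<forall>xs\<in>tuples A n. \<forall>i<n. \<forall>r\<in>carrier R. \<forall>x\<in>carrier A.
       g (xs[i := r \<odot>\<^bsub>A\<^esub> x]) = r \<odot>\<^bsub>M\<^esub> g (xs[i := x]))"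

text \<open>
  The linear map on \<open>A\<^bsup>\<otimes>n\<^esup>\<close> with prescribed values on pure tensors; by \<open>tensor_lift\<close> below it
  exists whenever these values depend multilinearly on the entries.
\<close>

definition tensor_lift ::
  "('k, 'r) ring_scheme \<Rightarrow> ('k, 'a, 'm) module_scheme \<Rightarrow> nat \<Rightarrow> ('k, 'b, 'n) module_scheme \<Rightarrow>
    ('a list \<Rightarrow> 'b) \<Rightarrow> ('a list \<Rightarrow> 'k) set \<Rightarrow> 'b"
  where "tensor_lift R A n M g = (THE h. h \<in> extensional (carrier (tensor_power R A n)) \<and>
    linear_map R (tensor_power R A n) M h \<and> (\<forall>xs\<in>tuples A n. h (pure_tensor R A xs) = g xs))"

lemma submodule_span_submodule:
  assumes "module R M" "G \<subseteq> carrier M"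
  shows "submodule (submodule_span R M G) R M"
proof -
  interpret module R M by fact
  have c: "submodule (carrier M) R M" by (rule carrier_is_submodule)
  show ?thesis unfolding submodule_span_def
  proof (rule submoduleI)
    show "\<Inter> {N. submodule N R M \<and> G \<subseteq> N} \<subseteq> carrier M" using c assms(2) by blast
    show "\<zero>\<^bsub>M\<^esub> \<in> \<Inter> {N. submodule N R M \<and> G \<subseteq> N}"
      using subgroup.one_closed[OF submodule.axioms(1), of _ R M] by (intro InterI) simp
  next
    fix a assume a: "a \<in> \<Inter> {N. submodule N R M \<and> G \<subseteq> N}"
    show "\<ominus>\<^bsub>M\<^esub> a \<in> \<Inter> {N. submodule N R M \<and> G \<subseteq> N}"
      by (intro InterI) (use a submoduleE(3) in blast)
  next
    fix a b assume a: "a \<in> \<Inter> {N. submodule N R M \<and> G \<subseteq> N}" "b \<in> \<Inter> {N. submodule N R M \<and> G \<subseteq> N}"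
    show "a \<oplus>\<^bsub>M\<^esub> b \<in> \<Inter> {N. submodule N R M \<and> G \<subseteq> N}"
      by (intro InterI) (use a submoduleE(5) in blast)
  next
    fix r a assume a: "a \<in> \<Inter> {N. submodule N R M \<and> G \<subseteq> N}" "r \<in> carrier R"
    show "r \<odot>\<^bsub>M\<^esub> a \<in> \<Inter> {N. submodule N R M \<and> G \<subseteq> N}"
      by (intro InterI) (use a submoduleE(4) in blast)
  qed
qed

lemma module_free_module:
  assumes "cring R"
  shows "module R (free_module R S)"
proof -
  interpret cring R by fact
  let ?F = "free_module R S"
  have fin: "finite {x. f x \<oplus>\<^bsub>R\<^esub> g x \<noteq> \<zero>\<^bsub>R\<^esub>}"
    if "finite {x. f x \<noteq> \<zero>\<^bsub>R\<^esub>}" "finite {x. g x \<noteq> \<zero>\<^bsub>R\<^esub>}" for f g :: "'c \<Rightarrow> 'a"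
    by (rule finite_subset[of _ "{x. f x \<noteq> \<zero>\<^bsub>R\<^esub>} \<union> {x. g x \<noteq> \<zero>\<^bsub>R\<^esub>}"]) (use that in auto)
  have fins: "finite {x. r \<otimes>\<^bsub>R\<^esub> f x \<noteq> \<zero>\<^bsub>R\<^esub>}"
    if "finite {x. f x \<noteq> \<zero>\<^bsub>R\<^esub>}" "r \<in> carrier R" for r and f :: "'c \<Rightarrow> 'a"
    by (rule finite_subset[of _ "{x. f x \<noteq> \<zero>\<^bsub>R\<^esub>}"]) (use that in auto)
  have C: "f \<in> carrier ?F \<longleftrightarrow> (\<forall>x. f x \<in> carrier R) \<and> (\<forall>x. x \<notin> S \<longrightarrow> f x = \<zero>\<^bsub>R\<^esub>) \<and> finite {x. f x \<noteq> \<zero>\<^bsub>R\<^esub>}" for f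
    unfolding free_module_def by (simp add: Pi_def) (metis zero_closed)
  have O: "f \<oplus>\<^bsub>?F\<^esub> g = (\<lambda>x. f x \<oplus>\<^bsub>R\<^esub> g x)" "r \<odot>\<^bsub>?F\<^esub> f = (\<lambda>x. r \<otimes>\<^bsub>R\<^esub> f x)" "\<zero>\<^bsub>?F\<^esub> = (\<lambda>x. \<zero>\<^bsub>R\<^esub>)" for f g r
    by (auto simp: free_module_def)
  show ?thesis
  proof (rule moduleI)
    show "abelian_group ?F"
    proof (rule abelian_groupI)
      fix f assume f: "f \<in> carrier ?F"
      have "{x. \<ominus>\<^bsub>R\<^esub> f x \<noteq> \<zero>\<^bsub>R\<^esub>} \<subseteq> {x. f x \<noteq> \<zero>\<^bsub>R\<^esub>}" by auto
      then have "(\<lambda>x. \<ominus>\<^bsub>R\<^esub> f x) \<in> carrier ?F"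
        using f by (auto simp: C intro: finite_subset)
      then show "\<exists>g\<in>carrier ?F. g \<oplus>\<^bsub>?F\<^esub> f = \<zero>\<^bsub>?F\<^esub>"
        using f by (intro bexI[of _ "\<lambda>x. \<ominus>\<^bsub>R\<^esub> f x"]) (auto simp: C O fun_eq_iff l_neg)
    next
      fix f g assume "f \<in> carrier ?F" "g \<in> carrier ?F"
      then show "f \<oplus>\<^bsub>?F\<^esub> g = g \<oplus>\<^bsub>?F\<^esub> f" by (simp add: C O a_comm)
    qed (auto simp: C O fin a_assoc)
  qed (auto simp: C O fins assms l_distr r_distr m_assoc)
qed

lemma quotient_module_facts:
  assumes "module R M" "submodule N R M"
  shows "x \<in> carrier M \<Longrightarrow> N +>\<^bsub>M\<^esub> x \<in> carrier (quotient_module M N)"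
    and "X \<in> carrier (quotient_module M N) \<Longrightarrow> \<exists>x\<in>carrier M. X = N +>\<^bsub>M\<^esub> x"
    and "\<lbrakk>x \<in> carrier M; y \<in> carrier M\<rbrakk> \<Longrightarrow>
      (N +>\<^bsub>M\<^esub> x) \<oplus>\<^bsub>quotient_module M N\<^esub> (N +>\<^bsub>M\<^esub> y) = N +>\<^bsub>M\<^esub> (x \<oplus>\<^bsub>M\<^esub> y)"
    and "\<lbrakk>r \<in> carrier R; x \<in> carrier M\<rbrakk> \<Longrightarrow>
      r \<odot>\<^bsub>quotient_module M N\<^esub> (N +>\<^bsub>M\<^esub> x) = N +>\<^bsub>M\<^esub> (r \<odot>\<^bsub>M\<^esub> x)"
    and "\<zero>\<^bsub>quotient_module M N\<^esub> = N +>\<^bsub>M\<^esub> \<zero>\<^bsub>M\<^esub>"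
    and "\<lbrakk>x \<in> carrier M; y \<in> carrier M\<rbrakk> \<Longrightarrow>
      N +>\<^bsub>M\<^esub> x = N +>\<^bsub>M\<^esub> y \<longleftrightarrow> x \<ominus>\<^bsub>M\<^esub> y \<in> N"
proof -
  interpret module R M by fact
  have N: "N \<subseteq> carrier M" by (rule submoduleE[OF assms(2)])
  interpret N: subgroup N "add_monoid M" by (rule submodule.axioms(1)[OF assms(2)])
  interpret N: abelian_subgroup N M
    by (intro abelian_subgroupI3 additive_subgroup.intro N.subgroup_axioms M.abelian_group_axioms)
  show 1: "x \<in> carrier M \<Longrightarrow> N +>\<^bsub>M\<^esub> x \<in> carrier (quotient_module M N)"
    by (auto simp: quotient_module_def A_RCOSETS_def')
  show "X \<in> carrier (quotient_module M N) \<Longrightarrow> \<exists>x\<in>carrier M. X = N +>\<^bsub>M\<^esub> x"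
    by (auto simp: quotient_module_def A_RCOSETS_def')
  show "\<lbrakk>x \<in> carrier M; y \<in> carrier M\<rbrakk> \<Longrightarrow>
      (N +>\<^bsub>M\<^esub> x) \<oplus>\<^bsub>quotient_module M N\<^esub> (N +>\<^bsub>M\<^esub> y) = N +>\<^bsub>M\<^esub> (x \<oplus>\<^bsub>M\<^esub> y)"
    by (simp add: quotient_module_def N.a_rcos_sum)
  show "\<zero>\<^bsub>quotient_module M N\<^esub> = N +>\<^bsub>M\<^esub> \<zero>\<^bsub>M\<^esub>"
    using N by (simp add: quotient_module_def a_coset_add_zero)
  show eq: "N +>\<^bsub>M\<^esub> x = N +>\<^bsub>M\<^esub> y \<longleftrightarrow> x \<ominus>\<^bsub>M\<^esub> y \<in> N" if "x \<in> carrier M" "y \<in> carrier M" for x y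
  proof
    assume "N +>\<^bsub>M\<^esub> x = N +>\<^bsub>M\<^esub> y"
    then have "x \<in> N +>\<^bsub>M\<^esub> y" using N.a_rcos_self[OF that(1)] by simp
    then show "x \<ominus>\<^bsub>M\<^esub> y \<in> N" using N.a_rcos_module[OF that(2,1)] by (simp add: a_minus_def)
  next
    assume "x \<ominus>\<^bsub>M\<^esub> y \<in> N"
    then have "x \<in> N +>\<^bsub>M\<^esub> y" using N.a_rcos_module[OF that(2,1)] by (simp add: a_minus_def)
    then show "N +>\<^bsub>M\<^esub> x = N +>\<^bsub>M\<^esub> y" using N.a_repr_independence'[of x y] that(2) by simp
  qed
  show "r \<odot>\<^bsub>quotient_module M N\<^esub> (N +>\<^bsub>M\<^esub> x) = N +>\<^bsub>M\<^esub> (r \<odot>\<^bsub>M\<^esub> x)"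
    if rx: "r \<in> carrier R" "x \<in> carrier M" for r x
  proof -
    have "N +>\<^bsub>M\<^esub> (r \<odot>\<^bsub>M\<^esub> z) = N +>\<^bsub>M\<^esub> (r \<odot>\<^bsub>M\<^esub> x)" if z: "z \<in> N +>\<^bsub>M\<^esub> x" for z
    proof -
      obtain h where h: "h \<in> N" "z = h \<oplus>\<^bsub>M\<^esub> x" using z by (auto simp: a_r_coset_def')
      have hc: "h \<in> carrier M" using h(1) N by blast
      have "r \<odot>\<^bsub>M\<^esub> z \<ominus>\<^bsub>M\<^esub> r \<odot>\<^bsub>M\<^esub> x = r \<odot>\<^bsub>M\<^esub> h"
        using hc rx h(2) by (simp add: smult_r_distr minus_eq M.a_assoc M.r_neg)
      then show ?thesis
        using rx hc h eq[of "r \<odot>\<^bsub>M\<^esub> z" "r \<odot>\<^bsub>M\<^esub> x"] submoduleE(4)[OF assms(2)] by simp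
    qed
    then have "(\<Union>z\<in>N +>\<^bsub>M\<^esub> x. N +>\<^bsub>M\<^esub> (r \<odot>\<^bsub>M\<^esub> z)) = (\<Union>z\<in>N +>\<^bsub>M\<^esub> x. N +>\<^bsub>M\<^esub> (r \<odot>\<^bsub>M\<^esub> x))"
      by (intro SUP_cong refl)
    also have "\<dots> = N +>\<^bsub>M\<^esub> (r \<odot>\<^bsub>M\<^esub> x)"
      using N.a_rcos_self[OF rx(2)] by (subst UN_constant) (simp split: if_split, blast)
    finally show ?thesis by (simp add: quotient_module_def)
  qed
qed

lemma module_quotient_module:
  assumes "module R M" "submodule N R M"
  shows "module R (quotient_module M N)"
proof -
  interpret module R M by fact
  note q = quotient_module_facts[OF assms]
  show ?thesis
  proof (rule moduleI)
    show "abelian_group (quotient_module M N)"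
    proof (rule abelian_groupI)
      fix X assume "X \<in> carrier (quotient_module M N)"
      then obtain x where x: "x \<in> carrier M" "X = N +>\<^bsub>M\<^esub> x" using q(2) by blast
      show "\<exists>Y\<in>carrier (quotient_module M N). Y \<oplus>\<^bsub>quotient_module M N\<^esub> X = \<zero>\<^bsub>quotient_module M N\<^esub>"
        using x q(1)[of "\<ominus>\<^bsub>M\<^esub> x"] q(3)[of "\<ominus>\<^bsub>M\<^esub> x" x] q(5)
        by (intro bexI[of _ "N +>\<^bsub>M\<^esub> (\<ominus>\<^bsub>M\<^esub> x)"]) (simp_all add: M.l_neg)
    next
      fix X Y assume "X \<in> carrier (quotient_module M N)" "Y \<in> carrier (quotient_module M N)"
      then obtain x y where xy: "x \<in> carrier M" "X = N +>\<^bsub>M\<^esub> x" "y \<in> carrier M" "Y = N +>\<^bsub>M\<^esub> y"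
        using q(2) by metis
      show "X \<oplus>\<^bsub>quotient_module M N\<^esub> Y \<in> carrier (quotient_module M N)"
        using xy q(1,3) by simp
      show "X \<oplus>\<^bsub>quotient_module M N\<^esub> Y = Y \<oplus>\<^bsub>quotient_module M N\<^esub> X"
        using xy q(3) M.a_comm by metis
      fix Z assume "Z \<in> carrier (quotient_module M N)"
      then obtain z where "z \<in> carrier M" "Z = N +>\<^bsub>M\<^esub> z" using q(2) by metis
      then show "X \<oplus>\<^bsub>quotient_module M N\<^esub> Y \<oplus>\<^bsub>quotient_module M N\<^esub> Z =
          X \<oplus>\<^bsub>quotient_module M N\<^esub> (Y \<oplus>\<^bsub>quotient_module M N\<^esub> Z)"
        using xy q(3) by (simp add: M.a_assoc)
    next
      show "\<zero>\<^bsub>quotient_module M N\<^esub> \<in> carrier (quotient_module M N)"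
        using q(1,5) by simp
    next
      fix X assume "X \<in> carrier (quotient_module M N)"
      then obtain x where "x \<in> carrier M" "X = N +>\<^bsub>M\<^esub> x" using q(2) by blast
      then show "\<zero>\<^bsub>quotient_module M N\<^esub> \<oplus>\<^bsub>quotient_module M N\<^esub> X = X"
        using q(3,5) by simp
    qed
  next
    fix r s X assume rs: "r \<in> carrier R" "s \<in> carrier R" and "X \<in> carrier (quotient_module M N)"
    then obtain x where x: "x \<in> carrier M" "X = N +>\<^bsub>M\<^esub> x" using q(2) by metis
    show "(r \<oplus>\<^bsub>R\<^esub> s) \<odot>\<^bsub>quotient_module M N\<^esub> X = r \<odot>\<^bsub>quotient_module M N\<^esub> X \<oplus>\<^bsub>quotient_module M N\<^esub> s \<odot>\<^bsub>quotient_module M N\<^esub> X"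
      using x rs q(3,4) by (simp add: smult_l_distr)
    show "(r \<otimes>\<^bsub>R\<^esub> s) \<odot>\<^bsub>quotient_module M N\<^esub> X = r \<odot>\<^bsub>quotient_module M N\<^esub> (s \<odot>\<^bsub>quotient_module M N\<^esub> X)"
      using x rs q(4) by (simp add: smult_assoc1)
  next
    fix r X Y assume r: "r \<in> carrier R"
      and "X \<in> carrier (quotient_module M N)" "Y \<in> carrier (quotient_module M N)"
    then obtain x y where "x \<in> carrier M" "X = N +>\<^bsub>M\<^esub> x" "y \<in> carrier M" "Y = N +>\<^bsub>M\<^esub> y"
      using q(2) by metis
    then show "r \<odot>\<^bsub>quotient_module M N\<^esub> (X \<oplus>\<^bsub>quotient_module M N\<^esub> Y) = r \<odot>\<^bsub>quotient_module M N\<^esub> X \<oplus>\<^bsub>quotient_module M N\<^esub> r \<odot>\<^bsub>quotient_module M N\<^esub> Y"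
      using r q(3,4) by (simp add: smult_r_distr)
  next
    fix r X assume r: "r \<in> carrier R" and "X \<in> carrier (quotient_module M N)"
    then obtain x where x: "x \<in> carrier M" "X = N +>\<^bsub>M\<^esub> x" using q(2) by blast
    show "r \<odot>\<^bsub>quotient_module M N\<^esub> X \<in> carrier (quotient_module M N)"
      using r x q(1,4) by simp
  next
    fix X assume "X \<in> carrier (quotient_module M N)"
    then obtain x where x: "x \<in> carrier M" "X = N +>\<^bsub>M\<^esub> x" using q(2) by blast
    show "\<one>\<^bsub>R\<^esub> \<odot>\<^bsub>quotient_module M N\<^esub> X = X"
      using x q(4)[of "\<one>\<^bsub>R\<^esub>" x] by simp
  qed (rule is_cring)
qed

lemma free_gen_closed: "cring R \<Longrightarrow> x \<in> S \<Longrightarrow> free_gen R x \<in> carrier (free_module R S)"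
  by (auto simp: free_module_def free_gen_def cring_def ring.ring_simprules Pi_def)

lemma tuples_update: "xs \<in> tuples A n \<Longrightarrow> x \<in> carrier A \<Longrightarrow> xs[i := x] \<in> tuples A n"
  by (auto simp: tuples_def dest: set_update_subset_insert[THEN subsetD])

lemma free_module_lift:
  assumes M: "module R M" and g: "g \<in> S \<rightarrow> carrier M"
  defines "h \<equiv> \<lambda>f. \<Oplus>\<^bsub>M\<^esub>x\<in>{x. f x \<noteq> \<zero>\<^bsub>R\<^esub>}. f x \<odot>\<^bsub>M\<^esub> g x"
  shows "linear_map R (free_module R S) M h" and "x \<in> S \<Longrightarrow> h (free_gen R x) = g x"
proof -
  interpret module R M by fact
  let ?F = "free_module R S"
  have clo: "f x \<in> carrier R" if "f \<in> carrier ?F" for f x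
    using that by (cases "x \<in> S") (auto simp: free_module_def)
  have supp: "x \<in> S" if "f \<in> carrier ?F" "f x \<noteq> \<zero>\<^bsub>R\<^esub>" for f x
    using that by (auto simp: free_module_def)
  have fin: "finite {x. f x \<noteq> \<zero>\<^bsub>R\<^esub>}" if "f \<in> carrier ?F" for f
    using that by (auto simp: free_module_def)
  have h: "h f = (\<Oplus>\<^bsub>M\<^esub>x\<in>T. f x \<odot>\<^bsub>M\<^esub> g x)"
    if "f \<in> carrier ?F" "finite T" "{x. f x \<noteq> \<zero>\<^bsub>R\<^esub>} \<subseteq> T" "T \<subseteq> S" for f T
    unfolding h_def
    by (rule M.add.finprod_mono_neutral_cong_left) (use that g clo[OF that(1)] in \<open>auto simp: Pi_def subset_iff\<close>)
  have mF: "module R ?F" by (rule module_free_module[OF is_cring])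
  interpret F: module R ?F by fact
  have add: "h (f1 \<oplus>\<^bsub>?F\<^esub> f2) = h f1 \<oplus>\<^bsub>M\<^esub> h f2" if f: "f1 \<in> carrier ?F" "f2 \<in> carrier ?F" for f1 f2
  proof -
    let ?T = "{x. f1 x \<noteq> \<zero>\<^bsub>R\<^esub>} \<union> {x. f2 x \<noteq> \<zero>\<^bsub>R\<^esub>}"
    have T: "finite ?T" "?T \<subseteq> S" using f fin supp by auto
    have e: "(f1 \<oplus>\<^bsub>?F\<^esub> f2) x = f1 x \<oplus>\<^bsub>R\<^esub> f2 x" for x by (simp add: free_module_def)
    have "h (f1 \<oplus>\<^bsub>?F\<^esub> f2) = (\<Oplus>\<^bsub>M\<^esub>x\<in>?T. (f1 \<oplus>\<^bsub>?F\<^esub> f2) x \<odot>\<^bsub>M\<^esub> g x)"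
      by (rule h) (use f T in \<open>auto simp: e\<close>)
    also have "\<dots> = (\<Oplus>\<^bsub>M\<^esub>x\<in>?T. f1 x \<odot>\<^bsub>M\<^esub> g x \<oplus>\<^bsub>M\<^esub> f2 x \<odot>\<^bsub>M\<^esub> g x)"
      by (rule M.finsum_cong') (use T g f clo supp in \<open>auto simp: e smult_l_distr Pi_def subset_iff\<close>)
    also have "\<dots> = (\<Oplus>\<^bsub>M\<^esub>x\<in>?T. f1 x \<odot>\<^bsub>M\<^esub> g x) \<oplus>\<^bsub>M\<^esub> (\<Oplus>\<^bsub>M\<^esub>x\<in>?T. f2 x \<odot>\<^bsub>M\<^esub> g x)"
      by (rule M.finsum_addf) (use T g f clo supp in \<open>auto simp: Pi_def subset_iff\<close>)
    also have "\<dots> = h f1 \<oplus>\<^bsub>M\<^esub> h f2" using h[of f1 ?T] h[of f2 ?T] f T by auto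
    finally show ?thesis .
  qed
  have smult: "h (r \<odot>\<^bsub>?F\<^esub> f) = r \<odot>\<^bsub>M\<^esub> h f" if f: "f \<in> carrier ?F" "r \<in> carrier R" for r f
  proof -
    let ?T = "{x. f x \<noteq> \<zero>\<^bsub>R\<^esub>}"
    have T: "finite ?T" "?T \<subseteq> S" using f fin supp by auto
    have e: "(r \<odot>\<^bsub>?F\<^esub> f) x = r \<otimes>\<^bsub>R\<^esub> f x" for x by (simp add: free_module_def)
    have "h (r \<odot>\<^bsub>?F\<^esub> f) = (\<Oplus>\<^bsub>M\<^esub>x\<in>?T. (r \<odot>\<^bsub>?F\<^esub> f) x \<odot>\<^bsub>M\<^esub> g x)"
      by (rule h) (use f T F.smult_closed in \<open>auto simp: e\<close>)
    also have "\<dots> = (\<Oplus>\<^bsub>M\<^esub>x\<in>?T. r \<odot>\<^bsub>M\<^esub> (f x \<odot>\<^bsub>M\<^esub> g x))"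
      by (rule M.finsum_cong') (use T g f clo supp in \<open>auto simp: e smult_assoc1 Pi_def subset_iff\<close>)
    also have "\<dots> = r \<odot>\<^bsub>M\<^esub> h f" unfolding h_def
      by (rule finsum_smult_ldistr[symmetric]) (use T g f clo supp in \<open>auto simp: Pi_def subset_iff\<close>)
    finally show ?thesis .
  qed
  have closed: "h f \<in> carrier M" if "f \<in> carrier ?F" for f
    unfolding h_def by (rule M.finsum_closed) (use g that clo supp in \<open>auto simp: Pi_def\<close>)
  show "linear_map R ?F M h"
    unfolding linear_map_def using M mF add smult closed by auto
  assume x: "x \<in> S"
  have "h (free_gen R x) = (\<Oplus>\<^bsub>M\<^esub>y\<in>{x}. free_gen R x y \<odot>\<^bsub>M\<^esub> g y)"
    by (rule h) (use x free_gen_closed[OF is_cring x] in \<open>auto simp: free_gen_def\<close>)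
  then show "h (free_gen R x) = g x"
    using x g by (auto simp: free_gen_def Pi_def)
qed

lemma linear_map_facts:
  assumes "linear_map R M N h"
  shows "submodule {x \<in> carrier M. h x = \<zero>\<^bsub>N\<^esub>} R M" and "h \<zero>\<^bsub>M\<^esub> = \<zero>\<^bsub>N\<^esub>"
    and "\<lbrakk>x \<in> carrier M; y \<in> carrier M\<rbrakk> \<Longrightarrow> h (x \<ominus>\<^bsub>M\<^esub> y) = h x \<ominus>\<^bsub>N\<^esub> h y"
proof -
  interpret M: module R M using assms by (simp add: linear_map_def)
  interpret N: module R N using assms by (simp add: linear_map_def)
  have add: "h (x \<oplus>\<^bsub>M\<^esub> y) = h x \<oplus>\<^bsub>N\<^esub> h y" if "x \<in> carrier M" "y \<in> carrier M" for x y
    using assms that by (simp add: linear_map_def)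
  have sm: "h (r \<odot>\<^bsub>M\<^esub> x) = r \<odot>\<^bsub>N\<^esub> h x" if "x \<in> carrier M" "r \<in> carrier R" for x r
    using assms that by (simp add: linear_map_def)
  have c: "h x \<in> carrier N" if "x \<in> carrier M" for x
    using assms that by (auto simp: linear_map_def)
  show z: "h \<zero>\<^bsub>M\<^esub> = \<zero>\<^bsub>N\<^esub>"
    using sm[of "\<zero>\<^bsub>M\<^esub>" "\<zero>\<^bsub>R\<^esub>"] c by simp
  have neg: "h (\<ominus>\<^bsub>M\<^esub> x) = \<ominus>\<^bsub>N\<^esub> h x" if "x \<in> carrier M" for x
    using sm[of x "\<ominus>\<^bsub>R\<^esub> \<one>\<^bsub>R\<^esub>"] c that by (simp add: M.smult_l_minus N.smult_l_minus)
  show "\<lbrakk>x \<in> carrier M; y \<in> carrier M\<rbrakk> \<Longrightarrow> h (x \<ominus>\<^bsub>M\<^esub> y) = h x \<ominus>\<^bsub>N\<^esub> h y"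
    by (simp add: a_minus_def add neg)
  show "submodule {x \<in> carrier M. h x = \<zero>\<^bsub>N\<^esub>} R M"
    by (rule M.submoduleI) (use add sm neg z in auto)
qed

lemma submodule_equalizer:
  assumes h: "linear_map R M N h" "linear_map R M N h'"
  shows "submodule {x \<in> carrier M. h x = h' x} R M"
proof -
  interpret M: module R M using assms by (simp add: linear_map_def)
  interpret N: module R N using assms by (simp add: linear_map_def)
  note k = linear_map_facts[OF h(1)] linear_map_facts[OF h(2)]
  have neg: "h (\<ominus>\<^bsub>M\<^esub> x) = h' (\<ominus>\<^bsub>M\<^esub> x)" if "x \<in> carrier M" "h x = h' x" for x
    using k(3)[of "\<zero>\<^bsub>M\<^esub>" x] k(6)[of "\<zero>\<^bsub>M\<^esub>" x] k(2,5) that by (simp add: a_minus_def)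
  show ?thesis
    by (rule M.submoduleI) (use h k(2,5) neg in \<open>auto simp: linear_map_def\<close>)
qed

lemma free_module_spanned:
  assumes R: "cring R" and N: "submodule N R (free_module R S)"
    and gen: "\<And>x. x \<in> S \<Longrightarrow> free_gen R x \<in> N" and f: "f \<in> carrier (free_module R S)"
  shows "f \<in> N"
proof -
  let ?F = "free_module R S"
  interpret R: cring R by fact
  interpret F: module R ?F by (rule module_free_module[OF R])
  note NE = F.submoduleE[OF N]
  have "f \<in> N" if "finite T" "f \<in> carrier ?F" "{x. f x \<noteq> \<zero>\<^bsub>R\<^esub>} \<subseteq> T" for T f
    using that
  proof (induction T arbitrary: f rule: finite_induct)
    case empty
    then have "f = \<zero>\<^bsub>?F\<^esub>" by (auto simp: free_module_def)
    then show ?case using subgroup.one_closed[OF submodule.axioms(1)[OF N]] by simp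
  next
    case (insert x T)
    have clo: "f y \<in> carrier R" for y
      using insert.prems by (cases "y \<in> S") (auto simp: free_module_def)
    let ?f' = "f(x := \<zero>\<^bsub>R\<^esub>)"
    have f': "?f' \<in> carrier ?F"
      using insert.prems by (auto simp: free_module_def intro: rev_finite_subset)
    have N': "?f' \<in> N" by (rule insert.IH[OF f']) (use insert.prems in auto)
    show ?case
    proof (cases "x \<in> S")
      case True
      have "f = ?f' \<oplus>\<^bsub>?F\<^esub> f x \<odot>\<^bsub>?F\<^esub> free_gen R x"
        using clo by (auto simp: free_module_def free_gen_def fun_eq_iff)
      then show ?thesis using NE(4)[OF clo gen[OF True]] NE(5) N' by metis
    next
      case False
      then have "f x = \<zero>\<^bsub>R\<^esub>" using insert.prems by (auto simp: free_module_def)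
      then have "?f' = f" by auto
      then show ?thesis using N' by simp
    qed
  qed
  then show ?thesis using f by (auto simp: free_module_def)
qed

lemma tensor_null_submodule:
  assumes "module R A"
  shows "submodule (tensor_null R A n) R (free_module R (tuples A n))"
proof -
  interpret module R A by fact
  let ?F = "free_module R (tuples A n)"
  have F: "module R ?F" by (rule module_free_module[OF is_cring])
  interpret F: module R ?F by fact
  have e: "free_gen R (xs[i := x]) \<in> carrier ?F" if "xs \<in> tuples A n" "x \<in> carrier A" for xs i x
    using free_gen_closed[OF is_cring tuples_update[OF that]] .
  have "tensor_relations R A n \<subseteq> carrier ?F"
    unfolding tensor_relations_def Let_def
    by (intro Un_least subsetI; elim CollectE exE conjE; hypsubst)
      (intro F.minus_closed e F.a_closed F.smult_closed M.a_closed smult_closed; assumption)+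
  then show ?thesis
    unfolding tensor_null_def by (rule submodule_span_submodule[OF F])
qed

lemma module_tensor_power: "module R A \<Longrightarrow> module R (tensor_power R A n)"
  unfolding tensor_power_def
  by (intro module_quotient_module module_free_module tensor_null_submodule) (simp add: module_def)

lemma pure_tensor_closed:
  assumes "module R A" "xs \<in> tuples A n"
  shows "pure_tensor R A xs \<in> carrier (tensor_power R A n)"
proof -
  have "cring R" "length xs = n" using assms by (auto simp: module_def tuples_def)
  then show ?thesis
    using quotient_module_facts(1)[OF module_free_module tensor_null_submodule[OF assms(1)]]
      free_gen_closed assms(2) unfolding tensor_power_def pure_tensor_def by metis
qed

lemma linear_map_eqI_pure_tensor:
  assumes A: "module R A"
    and h: "linear_map R (tensor_power R A n) M h" "linear_map R (tensor_power R A n) M h'"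
    and eq: "\<And>xs. xs \<in> tuples A n \<Longrightarrow> h (pure_tensor R A xs) = h' (pure_tensor R A xs)"
    and X: "X \<in> carrier (tensor_power R A n)"
  shows "h X = h' X"
proof -
  interpret A: module R A by fact
  let ?F = "free_module R (tuples A n)" and ?N = "tensor_null R A n"
  have F: "module R ?F" by (rule module_free_module[OF A.is_cring])
  interpret F: module R ?F by fact
  note q = quotient_module_facts[OF F tensor_null_submodule[OF A], folded tensor_power_def]
  interpret T: module R "tensor_power R A n" by (rule module_tensor_power[OF A])
  let ?E = "{Y \<in> carrier (tensor_power R A n). h Y = h' Y}"
  have E: "submodule ?E R (tensor_power R A n)" by (rule submodule_equalizer[OF h])
  note EE = T.submoduleE[OF E]
  obtain f where f: "f \<in> carrier ?F" "X = ?N +>\<^bsub>?F\<^esub> f" using q(2)[OF X] by blast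
  have lin: "linear_map R ?F (tensor_power R A n) (\<lambda>f. ?N +>\<^bsub>?F\<^esub> f)"
    unfolding linear_map_def using F T.module_axioms q(1,3,4) by auto
  let ?P = "{g \<in> carrier ?F. ?N +>\<^bsub>?F\<^esub> g \<in> ?E}"
  have "submodule ?P R ?F"
  proof (rule F.submoduleI)
    show "\<zero>\<^bsub>?F\<^esub> \<in> ?P"
      using subgroup.one_closed[OF submodule.axioms(1)[OF E]] by (simp add: q(5))
  next
    fix a assume a: "a \<in> ?P"
    have "?N +>\<^bsub>?F\<^esub> (\<ominus>\<^bsub>R\<^esub> \<one>\<^bsub>R\<^esub> \<odot>\<^bsub>?F\<^esub> a) \<in> ?E"
      using a EE(4)[of "\<ominus>\<^bsub>R\<^esub> \<one>\<^bsub>R\<^esub>"] q(4)[of "\<ominus>\<^bsub>R\<^esub> \<one>\<^bsub>R\<^esub>" a] by (metis (no_types, lifting) A.R.a_inv_closed A.R.one_closed mem_Collect_eq)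
    then show "\<ominus>\<^bsub>?F\<^esub> a \<in> ?P" using a by (simp add: F.smult_l_minus)
  next
    fix a b assume "a \<in> ?P" "b \<in> ?P"
    then show "a \<oplus>\<^bsub>?F\<^esub> b \<in> ?P" using EE(5) q(3) by (metis (no_types, lifting) F.a_closed mem_Collect_eq)
  next
    fix r a assume "r \<in> carrier R" "a \<in> ?P"
    then show "r \<odot>\<^bsub>?F\<^esub> a \<in> ?P" using EE(4) q(4) by (metis (no_types, lifting) F.smult_closed mem_Collect_eq)
  qed auto
  moreover have "free_gen R xs \<in> ?P" if "xs \<in> tuples A n" for xs
    using eq[OF that] pure_tensor_closed[OF A that] free_gen_closed[OF A.is_cring that] that
    by (auto simp: pure_tensor_def tuples_def)
  ultimately have "f \<in> ?P" using free_module_spanned[OF A.is_cring] f(1) by blast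
  then show ?thesis using f(2) by simp
qed

theorem tensor_lift:
  assumes A: "module R A" and M: "module R M" and g: "multilinear R A n M g"
  shows "linear_map R (tensor_power R A n) M (tensor_lift R A n M g)"
    and "xs \<in> tuples A n \<Longrightarrow> tensor_lift R A n M g (pure_tensor R A xs) = g xs"
proof -
  interpret A: module R A by fact
  interpret M: module R M by fact
  let ?F = "free_module R (tuples A n)" and ?N = "tensor_null R A n" and ?T = "tensor_power R A n"
  have F: "module R ?F" by (rule module_free_module[OF A.is_cring])
  interpret F: module R ?F by fact
  have N: "submodule ?N R ?F" by (rule tensor_null_submodule[OF A])
  note q = quotient_module_facts[OF F N, folded tensor_power_def]
  have T: "module R ?T" by (rule module_tensor_power[OF A])
  have gc: "g \<in> tuples A n \<rightarrow> carrier M" using g by (simp add: multilinear_def)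
  define h where "h = (\<lambda>f. \<Oplus>\<^bsub>M\<^esub>x\<in>{x. f x \<noteq> \<zero>\<^bsub>R\<^esub>}. f x \<odot>\<^bsub>M\<^esub> g x)"
  have h: "linear_map R ?F M h" "\<And>xs. xs \<in> tuples A n \<Longrightarrow> h (free_gen R xs) = g xs"
    using free_module_lift[OF M gc] unfolding h_def by auto
  have hl: "h (a \<oplus>\<^bsub>?F\<^esub> b) = h a \<oplus>\<^bsub>M\<^esub> h b" "h (r \<odot>\<^bsub>?F\<^esub> a) = r \<odot>\<^bsub>M\<^esub> h a" "h a \<in> carrier M"
    if "a \<in> carrier ?F" "b \<in> carrier ?F" "r \<in> carrier R" for a b r
    using h(1) that by (auto simp: linear_map_def)
  note k = linear_map_facts[OF h(1)]
  let ?K = "{f \<in> carrier ?F. h f = \<zero>\<^bsub>M\<^esub>}"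
  have e: "free_gen R (xs[i := x]) \<in> carrier ?F" "h (free_gen R (xs[i := x])) = g (xs[i := x])"
    "g (xs[i := x]) \<in> carrier M"
    if "xs \<in> tuples A n" "x \<in> carrier A" for xs i x
    using free_gen_closed[OF A.is_cring tuples_update[OF that]] h(2)[OF tuples_update[OF that]]
      gc tuples_update[OF that] by auto
  have "tensor_relations R A n \<subseteq> ?K"
  proof
    fix u assume "u \<in> tensor_relations R A n"
    then consider xs i x y where "xs \<in> tuples A n" "i < n" "x \<in> carrier A" "y \<in> carrier A"
        "u = free_gen R (xs[i := x \<oplus>\<^bsub>A\<^esub> y]) \<ominus>\<^bsub>?F\<^esub> (free_gen R (xs[i := x]) \<oplus>\<^bsub>?F\<^esub> free_gen R (xs[i := y]))"
      | xs i r x where "xs \<in> tuples A n" "i < n" "r \<in> carrier R" "x \<in> carrier A"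
        "u = free_gen R (xs[i := r \<odot>\<^bsub>A\<^esub> x]) \<ominus>\<^bsub>?F\<^esub> (r \<odot>\<^bsub>?F\<^esub> free_gen R (xs[i := x]))"
      unfolding tensor_relations_def Let_def by blast
    then show "u \<in> ?K"
    proof cases
      case 1
      then have "g (xs[i := x \<oplus>\<^bsub>A\<^esub> y]) = g (xs[i := x]) \<oplus>\<^bsub>M\<^esub> g (xs[i := y])"
        using g by (auto simp: multilinear_def)
      then show ?thesis
        using 1 e[OF 1(1)] hl(1)[OF _ _ A.R.zero_closed] k(3) by (simp add: M.r_neg a_minus_def[of M])
    next
      case 2
      then have "g (xs[i := r \<odot>\<^bsub>A\<^esub> x]) = r \<odot>\<^bsub>M\<^esub> g (xs[i := x])"
        using g by (auto simp: multilinear_def)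
      then show ?thesis
        using 2 e[OF 2(1)] hl(2)[OF _ F.zero_closed] k(3) by (simp add: M.r_neg a_minus_def[of M])
    qed
  qed
  then have NK: "?N \<subseteq> ?K"
    unfolding tensor_null_def submodule_span_def using k(1) by blast
  have wd: "h a = h b" if "a \<in> carrier ?F" "b \<in> carrier ?F" "?N +>\<^bsub>?F\<^esub> a = ?N +>\<^bsub>?F\<^esub> b" for a b
  proof -
    have "a \<ominus>\<^bsub>?F\<^esub> b \<in> ?N" using q(6)[OF that(1,2)] that(3) by simp
    then have 0: "h a \<ominus>\<^bsub>M\<^esub> h b = \<zero>\<^bsub>M\<^esub>" using NK k(3)[OF that(1,2)] by auto
    have c: "h a \<in> carrier M" "h b \<in> carrier M"
      using hl(3)[OF _ F.zero_closed A.R.zero_closed] that by blast+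
    have "(h a \<ominus>\<^bsub>M\<^esub> h b) \<oplus>\<^bsub>M\<^esub> h b = h a" using c by (simp add: a_minus_def M.a_assoc M.l_neg)
    then show ?thesis using 0 c by simp
  qed
  define rep where "rep = (\<lambda>X. SOME a. a \<in> carrier ?F \<and> X = ?N +>\<^bsub>?F\<^esub> a)"
  have rep: "rep X \<in> carrier ?F" "X = ?N +>\<^bsub>?F\<^esub> rep X" if "X \<in> carrier ?T" for X
  proof -
    have "\<exists>a. a \<in> carrier ?F \<and> X = ?N +>\<^bsub>?F\<^esub> a" using q(2)[OF that] by blast
    from someI_ex[OF this] have *: "rep X \<in> carrier ?F \<and> X = ?N +>\<^bsub>?F\<^esub> rep X"
      by (simp only: rep_def)
    show "rep X \<in> carrier ?F" by (rule conjunct1[OF *])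
    show "X = ?N +>\<^bsub>?F\<^esub> rep X" by (rule conjunct2[OF *])
  qed
  define H where "H = restrict (\<lambda>X. h (rep X)) (carrier ?T)"
  have H: "H (?N +>\<^bsub>?F\<^esub> a) = h a" if "a \<in> carrier ?F" for a
  proof -
    note r = rep[OF q(1)[OF that]]
    have "H (?N +>\<^bsub>?F\<^esub> a) = h (rep (?N +>\<^bsub>?F\<^esub> a))" using q(1)[OF that] by (simp add: H_def)
    also have "\<dots> = h a" by (rule wd[OF r(1) that r(2)[symmetric]])
    finally show ?thesis .
  qed
  have Hlin: "linear_map R ?T M H"
    unfolding linear_map_def
  proof (intro conjI ballI T M)
    show "H \<in> carrier ?T \<rightarrow> carrier M"
      using rep(1) hl(3)[OF _ F.zero_closed A.R.zero_closed] by (auto simp: H_def)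
  next
    fix X Y assume "X \<in> carrier ?T" "Y \<in> carrier ?T"
    then obtain a b where "a \<in> carrier ?F" "X = ?N +>\<^bsub>?F\<^esub> a" "b \<in> carrier ?F" "Y = ?N +>\<^bsub>?F\<^esub> b"
      using q(2) by metis
    then show "H (X \<oplus>\<^bsub>?T\<^esub> Y) = H X \<oplus>\<^bsub>M\<^esub> H Y"
      by (simp add: q(3) H hl(1)[OF _ _ A.R.zero_closed])
  next
    fix r X assume "r \<in> carrier R" "X \<in> carrier ?T"
    moreover from this obtain a where "a \<in> carrier ?F" "X = ?N +>\<^bsub>?F\<^esub> a"
      using q(2) by metis
    ultimately show "H (r \<odot>\<^bsub>?T\<^esub> X) = r \<odot>\<^bsub>M\<^esub> H X"
      by (simp add: q(4) H hl(2)[OF _ F.zero_closed])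
  qed
  have Hg: "H (pure_tensor R A xs) = g xs" if "xs \<in> tuples A n" for xs
    using H[OF free_gen_closed[OF A.is_cring that]] h(2)[OF that] that
    by (simp add: pure_tensor_def tuples_def)
  have Hext: "H \<in> extensional (carrier ?T)" by (simp add: H_def)
  let ?P = "\<lambda>h. h \<in> extensional (carrier ?T) \<and> linear_map R ?T M h \<and>
    (\<forall>xs\<in>tuples A n. h (pure_tensor R A xs) = g xs)"
  have "?P (tensor_lift R A n M g)"
    unfolding tensor_lift_def
  proof (rule theI[where P = ?P])
    show "?P H" using Hlin Hg Hext by blast
    fix h' assume h': "?P h'"
    show "h' = H"
    proof (rule extensionalityI[OF conjunct1[OF h'] Hext])
      fix X assume X: "X \<in> carrier ?T"
      show "h' X = H X"
        by (rule linear_map_eqI_pure_tensor[OF A _ Hlin _ X]) (use h' Hg in auto)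
    qed
  qed
  then show "linear_map R ?T M (tensor_lift R A n M g)"
    and "xs \<in> tuples A n \<Longrightarrow> tensor_lift R A n M g (pure_tensor R A xs) = g xs" by blast+
qed

section \<open>Homology\<close>

text \<open>
  A complex \<open>\<cdots> \<rightarrow> C\<^sub>2 \<rightarrow> C\<^sub>1 \<rightarrow> C\<^sub>0\<close> is given by \<open>C\<close> and \<open>d\<close>, where \<open>d n\<close> maps \<open>C (n + 1)\<close> to \<open>C n\<close>.
\<close>

definition cycles ::
  "(nat \<Rightarrow> ('k, 'a, 'm) module_scheme) \<Rightarrow> (nat \<Rightarrow> 'a \<Rightarrow> 'a) \<Rightarrow> nat \<Rightarrow> 'a set"
  where "cycles C d n =
    (case n of 0 \<Rightarrow> carrier (C 0) | Suc m \<Rightarrow> {z \<in> carrier (C (Suc m)). d m z = \<zero>\<^bsub>C m\<^esub>})"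

definition boundaries ::
  "(nat \<Rightarrow> ('k, 'a, 'm) module_scheme) \<Rightarrow> (nat \<Rightarrow> 'a \<Rightarrow> 'a) \<Rightarrow> nat \<Rightarrow> 'a set"
  where "boundaries C d n = d n ` carrier (C (Suc n))"

definition homology ::
  "(nat \<Rightarrow> ('k, 'a, 'm) module_scheme) \<Rightarrow> (nat \<Rightarrow> 'a \<Rightarrow> 'a) \<Rightarrow> nat \<Rightarrow> ('k, 'a set) module"
  where "homology C d n = quotient_module ((C n)\<lparr>carrier := cycles C d n\<rparr>) (boundaries C d n)"

definition homology_class ::
  "(nat \<Rightarrow> ('k, 'a, 'm) module_scheme) \<Rightarrow> (nat \<Rightarrow> 'a \<Rightarrow> 'a) \<Rightarrow> nat \<Rightarrow> 'a \<Rightarrow> 'a set"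
  where "homology_class C d n z = boundaries C d n +>\<^bsub>C n\<^esub> z"

text \<open>
  The map \<open>[z] \<mapsto> [\<phi> z]\<close> into the \<open>n\<close>-th homology of \<open>(D, e)\<close>. If the class of \<open>\<phi> z\<close> does not depend
  on the representative \<open>z\<close>, the union is over copies of this one class.
\<close>

definition homology_map ::
  "(nat \<Rightarrow> ('k, 'b, 'm) module_scheme) \<Rightarrow> (nat \<Rightarrow> 'b \<Rightarrow> 'b) \<Rightarrow> nat \<Rightarrow> ('a \<Rightarrow> 'b) \<Rightarrow> 'a set \<Rightarrow> 'b set"
  where "homology_map D e n \<phi> X = (\<Union>z\<in>X. homology_class D e n (\<phi> z))"

section \<open>Associative algebras\<close>

text \<open>
  No unit is required, and the field \<open>one\<close> is ignored; unital algebras are a special case.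
  (The locale \<^locale>\<open>algebra\<close> of \<^theory>\<open>HOL-Algebra.Module\<close> is for commutative unital algebras.)
\<close>

locale assoc_algebra = module R A for R (structure) and A (structure) +
  assumes alg_mult_closed: "\<lbrakk>x \<in> carrier A; y \<in> carrier A\<rbrakk> \<Longrightarrow> x \<otimes>\<^bsub>A\<^esub> y \<in> carrier A"
    and alg_mult_assoc: "\<lbrakk>x \<in> carrier A; y \<in> carrier A; z \<in> carrier A\<rbrakk> \<Longrightarrow>
      (x \<otimes>\<^bsub>A\<^esub> y) \<otimes>\<^bsub>A\<^esub> z = x \<otimes>\<^bsub>A\<^esub> (y \<otimes>\<^bsub>A\<^esub> z)"
    and alg_mult_distl: "\<lbrakk>x \<in> carrier A; y \<in> carrier A; z \<in> carrier A\<rbrakk> \<Longrightarrow>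
      (x \<oplus>\<^bsub>A\<^esub> y) \<otimes>\<^bsub>A\<^esub> z = x \<otimes>\<^bsub>A\<^esub> z \<oplus>\<^bsub>A\<^esub> y \<otimes>\<^bsub>A\<^esub> z"
    and alg_mult_distr: "\<lbrakk>x \<in> carrier A; y \<in> carrier A; z \<in> carrier A\<rbrakk> \<Longrightarrow>
      z \<otimes>\<^bsub>A\<^esub> (x \<oplus>\<^bsub>A\<^esub> y) = z \<otimes>\<^bsub>A\<^esub> x \<oplus>\<^bsub>A\<^esub> z \<otimes>\<^bsub>A\<^esub> y"
    and alg_smult_multl: "\<lbrakk>r \<in> carrier R; x \<in> carrier A; y \<in> carrier A\<rbrakk> \<Longrightarrow>
      (r \<odot>\<^bsub>A\<^esub> x) \<otimes>\<^bsub>A\<^esub> y = r \<odot>\<^bsub>A\<^esub> (x \<otimes>\<^bsub>A\<^esub> y)"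
    and alg_smult_multr: "\<lbrakk>r \<in> carrier R; x \<in> carrier A; y \<in> carrier A\<rbrakk> \<Longrightarrow>
      x \<otimes>\<^bsub>A\<^esub> (r \<odot>\<^bsub>A\<^esub> y) = r \<odot>\<^bsub>A\<^esub> (x \<otimes>\<^bsub>A\<^esub> y)"

definition algebra_hom ::
  "('k, 'r) ring_scheme \<Rightarrow> ('k, 'a, 'm) module_scheme \<Rightarrow> ('k, 'b, 'n) module_scheme \<Rightarrow> ('a \<Rightarrow> 'b) \<Rightarrow> bool"
  where "algebra_hom R A B f \<longleftrightarrow> linear_map R A B f \<and>
    (\<forall>x\<in>carrier A. \<forall>y\<in>carrier A. f (x \<otimes>\<^bsub>A\<^esub> y) = f x \<otimes>\<^bsub>B\<^esub> f y)"

definition commutator :: "('k, 'a, 'm) module_scheme \<Rightarrow> 'a \<Rightarrow> 'a \<Rightarrow> 'a"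
  where "commutator A a b = a \<otimes>\<^bsub>A\<^esub> b \<ominus>\<^bsub>A\<^esub> b \<otimes>\<^bsub>A\<^esub> a"

definition tensor_power_map ::
  "('k, 'r) ring_scheme \<Rightarrow> ('k, 'a, 'm) module_scheme \<Rightarrow> ('k, 'b, 'n) module_scheme \<Rightarrow> ('a \<Rightarrow> 'b) \<Rightarrow>
    nat \<Rightarrow> ('a list \<Rightarrow> 'k) set \<Rightarrow> ('b list \<Rightarrow> 'k) set"
  where "tensor_power_map R A B f n =
    tensor_lift R A n (tensor_power R B n) (\<lambda>xs. pure_tensor R B (map f xs))"

section \<open>Leibniz and Hochschild homology\<close>

text \<open>
  \<open>leibniz_diff R A n\<close> maps \<open>A\<^bsup>\<otimes>(n+1)\<^esup>\<close> to \<open>A\<^bsup>\<otimes>n\<^esup>\<close>. For \<open>n = 0\<close> the sum is empty, which gives the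
  zero map from \<open>A\<close> to the ground ring.
\<close>

definition leibniz_diff ::
  "('k, 'r) ring_scheme \<Rightarrow> ('k, 'a, 'm) module_scheme \<Rightarrow> nat \<Rightarrow> ('a list \<Rightarrow> 'k) set \<Rightarrow> ('a list \<Rightarrow> 'k) set"
  where "leibniz_diff R A n = tensor_lift R A (Suc n) (tensor_power R A n)
    (\<lambda>xs. \<Oplus>\<^bsub>tensor_power R A n\<^esub>p\<in>{(i, j). i < j \<and> j \<le> n}. case p of (i, j) \<Rightarrow>
       [((-1 :: int) ^ (j + 1))] \<cdot>\<^bsub>tensor_power R A n\<^esub>
         pure_tensor R A (take j (xs[i := commutator A (xs ! i) (xs ! j)]) @ drop (Suc j) xs))"

definition leibniz_chain ::
  "('k, 'r) ring_scheme \<Rightarrow> ('k, 'a, 'm) module_scheme \<Rightarrow> nat \<Rightarrow> ('k, ('a list \<Rightarrow> 'k) set) module"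
  where "leibniz_chain R A n = tensor_power R A n"

definition hochschild_chain ::
  "('k, 'r) ring_scheme \<Rightarrow> ('k, 'a, 'm) module_scheme \<Rightarrow> nat \<Rightarrow> ('k, ('a list \<Rightarrow> 'k) set) module"
  where "hochschild_chain R A n = tensor_power R A (Suc n)"

definition hochschild_face :: "('k, 'a, 'm) module_scheme \<Rightarrow> nat \<Rightarrow> nat \<Rightarrow> 'a list \<Rightarrow> 'a list"
  where "hochschild_face A n i xs =
    (if i < n then take i xs @ (xs ! i \<otimes>\<^bsub>A\<^esub> xs ! Suc i) # drop (i + 2) xs
     else (xs ! n \<otimes>\<^bsub>A\<^esub> xs ! 0) # map ((!) xs) [1..<n])"

text \<open>\<open>hochschild_diff R A n\<close> is \<open>b\<close> on \<open>CHH\<^bsub>n+1\<^esub>(A) = A\<^bsup>\<otimes>(n+2)\<^esup>\<close>, with values in \<open>CHH\<^sub>n(A)\<close>.\<close>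

definition hochschild_diff ::
  "('k, 'r) ring_scheme \<Rightarrow> ('k, 'a, 'm) module_scheme \<Rightarrow> nat \<Rightarrow> ('a list \<Rightarrow> 'k) set \<Rightarrow> ('a list \<Rightarrow> 'k) set"
  where "hochschild_diff R A n = tensor_lift R A (Suc (Suc n)) (tensor_power R A (Suc n))
    (\<lambda>xs. \<Oplus>\<^bsub>tensor_power R A (Suc n)\<^esub>i\<in>{0..Suc n}.
       [((-1 :: int) ^ i)] \<cdot>\<^bsub>tensor_power R A (Suc n)\<^esub> pure_tensor R A (hochschild_face A (Suc n) i xs))"

definition leibniz_homology ::
  "('k, 'r) ring_scheme \<Rightarrow> ('k, 'a, 'm) module_scheme \<Rightarrow> nat \<Rightarrow> ('k, ('a list \<Rightarrow> 'k) set set) module"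
  where "leibniz_homology R A = homology (leibniz_chain R A) (leibniz_diff R A)"

definition hochschild_homology ::
  "('k, 'r) ring_scheme \<Rightarrow> ('k, 'a, 'm) module_scheme \<Rightarrow> nat \<Rightarrow> ('k, ('a list \<Rightarrow> 'k) set set) module"
  where "hochschild_homology R A = homology (hochschild_chain R A) (hochschild_diff R A)"

definition leibniz_homology_map ::
  "('k, 'r) ring_scheme \<Rightarrow> ('k, 'a, 'm) module_scheme \<Rightarrow> ('k, 'b, 'n) module_scheme \<Rightarrow> ('a \<Rightarrow> 'b) \<Rightarrow>
    nat \<Rightarrow> ('a list \<Rightarrow> 'k) set set \<Rightarrow> ('b list \<Rightarrow> 'k) set set"
  where "leibniz_homology_map R A B f n =
    homology_map (leibniz_chain R B) (leibniz_diff R B) n (tensor_power_map R A B f n)"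

definition hochschild_homology_map ::
  "('k, 'r) ring_scheme \<Rightarrow> ('k, 'a, 'm) module_scheme \<Rightarrow> ('k, 'b, 'n) module_scheme \<Rightarrow> ('a \<Rightarrow> 'b) \<Rightarrow>
    nat \<Rightarrow> ('a list \<Rightarrow> 'k) set set \<Rightarrow> ('b list \<Rightarrow> 'k) set set"
  where "hochschild_homology_map R A B f n =
    homology_map (hochschild_chain R B) (hochschild_diff R B) n (tensor_power_map R A B f (Suc n))"

section \<open>Antisymmetrization\<close>

definition antisymmetrization ::
  "('k, 'r) ring_scheme \<Rightarrow> ('k, 'a, 'm) module_scheme \<Rightarrow> nat \<Rightarrow> ('a list \<Rightarrow> 'k) set \<Rightarrow> ('a list \<Rightarrow> 'k) set"
  where "antisymmetrization R A n = tensor_lift R A (Suc n) (tensor_power R A (Suc n))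
    (\<lambda>xs. \<Oplus>\<^bsub>tensor_power R A (Suc n)\<^esub>\<sigma>\<in>{\<sigma>. \<sigma> permutes {1..n}}.
       [(sign \<sigma>)] \<cdot>\<^bsub>tensor_power R A (Suc n)\<^esub>
         pure_tensor R A (xs ! 0 # map (\<lambda>i. xs ! (Hilbert_Choice.inv \<sigma> i)) [1..<Suc n]))"

definition antisym_homology ::
  "('k, 'r) ring_scheme \<Rightarrow> ('k, 'a, 'm) module_scheme \<Rightarrow> nat \<Rightarrow>
    ('a list \<Rightarrow> 'k) set set \<Rightarrow> ('a list \<Rightarrow> 'k) set set"
  where "antisym_homology R A n =
    homology_map (hochschild_chain R A) (hochschild_diff R A) n (antisymmetrization R A n)"

end

theory Submission
  imports Defs
begin

text \<open>
  Everything rests on the chain map identity \<open>b \<circ> \<phi>\<^sub>N = \<phi>\<^sub>n \<circ> d\<close> on \<open>A\<^bsup>\<otimes>(N+1)\<^esup>\<close>, where \<open>N = n + 1\<close>. Each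
  summand on either side merges two entries of a permuted tensor, so both sides can be written with
  the same terms. For a permutation \<open>D\<close> of \<open>{1..N}\<close>, extended by \<open>D 0 = 0\<close>, an index \<open>i < N\<close> and a
  bilinear operation \<open>\<mu>\<close>, let \<open>T\<^sub>\<mu>(D, i)\<close> be the tensor \<open>(a\<^bsub>D 0\<^esub>, \<dots>, a\<^bsub>D (N-1)\<^esub>)\<close> with the entry at
  position \<open>i\<close> replaced by \<open>\<mu>(a\<^bsub>D i\<^esub>, a\<^bsub>D N\<^esub>)\<close>: the last entry is absorbed into the \<open>i\<close>-th one. Let
  \<open>m\<close> be the product, \<open>m'\<close> the opposite product and \<open>[\<cdot>,\<cdot>] = m - m'\<close>.

  \<^item> The face \<open>d\<^sub>i\<close> with \<open>i < N\<close> of the tensor permuted by \<open>s\<close> is \<open>T\<^sub>m(s \<circ> c, i)\<close>, where the cycle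
    \<open>c\<close> moves position \<open>i + 1\<close> to the end. The sign of \<open>c\<close> turns \<open>(-1)\<^sup>i sgn s\<close> into
    \<open>(-1)\<^sup>n sgn D\<close>, independently of \<open>i\<close>. The last face is \<open>T\<^bsub>m'\<^esub>(s, 0)\<close>, with sign
    \<open>(-1)\<^sup>N sgn s\<close>. Hence \<open>b \<phi>\<close> is \<open>(-1)\<^sup>n\<close> times the sum of \<open>sgn D T\<^sub>m(D, i)\<close> over all \<open>(D, i)\<close>,
    minus \<open>(-1)\<^sup>n\<close> times the sum of \<open>sgn D T\<^bsub>m'\<^esub>(D, 0)\<close> over all \<open>D\<close> (\<open>sum_hochschild\<close>).

  \<^item> The summand of \<open>\<phi> d\<close> given by \<open>p < q\<close> and a permutation \<open>t\<close> of \<open>{1..n}\<close> is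
    \<open>(-1)\<^sup>n sgn D T\<^bsub>[\<cdot>,\<cdot>]\<^esub>(D, i)\<close>, where \<open>D\<close> is \<open>t\<close> followed by the cycle moving \<open>q\<close> to the end, and
    \<open>D i = p\<close>. Since \<open>D N = q\<close>, the pair \<open>(D, i)\<close> determines \<open>p\<close>, \<open>q\<close> and \<open>t\<close>, and the pairs that
    occur are those with \<open>D i < D N\<close> (\<open>sum_leibniz\<close>).

  \<^item> Expanding the commutators and transposing \<open>i\<close> and \<open>N\<close> in the terms with \<open>m'\<close> makes the two
    sums agree; the terms with \<open>i = 0\<close>, for which the transposition is not available, account for the
    last face (\<open>sum_commutators\<close>).

  The remaining statements are formal. All maps in question are linear extensions of signed sums of
  list operations that are linear in each entry (\<open>entrywise_linear\<close>), and an algebra homomorphism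
  commutes with these list operations, which gives naturality on chains. A linear map that preserves
  cycles and boundaries then induces a linear map on homology classes (\<open>homology_morphism\<close>).
\<close>

section \<open>Signed sums in a module\<close>

text \<open>
  Integer multiples are scalar multiples, so everything proved for scalars and for linear maps
  applies to signs.
\<close>

lemma (in module) add_pow_eq_smult:
  assumes x: "x \<in> carrier M"
  shows "[(c :: int)] \<cdot>\<^bsub>M\<^esub> x = ([c] \<cdot>\<^bsub>R\<^esub> \<one>\<^bsub>R\<^esub>) \<odot>\<^bsub>M\<^esub> x"
proof -
  have nat: "[(n :: nat)] \<cdot>\<^bsub>M\<^esub> x = ([n] \<cdot>\<^bsub>R\<^esub> \<one>\<^bsub>R\<^esub>) \<odot>\<^bsub>M\<^esub> x" for n
    by (induction n) (use x in \<open>simp_all add: smult_l_distr smult_l_null\<close>)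
  show ?thesis
    using x by (cases "0 \<le> c") (simp_all add: add_pow_int_ge add_pow_int_lt nat smult_l_minus)
qed

lemma (in module) sign_smult_closed [simp]:
  "x \<in> carrier M \<Longrightarrow> [(c :: int)] \<cdot>\<^bsub>M\<^esub> x \<in> carrier M"
  by (rule M.add.int_pow_closed)

lemma (in module) add_pow_add_pow:
  "x \<in> carrier M \<Longrightarrow> [(c :: int)] \<cdot>\<^bsub>M\<^esub> ([(d :: int)] \<cdot>\<^bsub>M\<^esub> x) = [(c * d)] \<cdot>\<^bsub>M\<^esub> x"
  using M.add.int_pow_pow[of x d c] M.add.int_pow_pow[of x c d] by (simp add: mult.commute)

lemma (in module) add_pow_minus_int:
  "x \<in> carrier M \<Longrightarrow> [(- c :: int)] \<cdot>\<^bsub>M\<^esub> x = \<ominus>\<^bsub>M\<^esub> ([c] \<cdot>\<^bsub>M\<^esub> x)"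
  by (rule M.add.int_pow_neg)

lemma (in module) add_pow_minus_distrib:
  assumes "x \<in> carrier M" "y \<in> carrier M"
  shows "[(c :: int)] \<cdot>\<^bsub>M\<^esub> (x \<ominus>\<^bsub>M\<^esub> y) = [c] \<cdot>\<^bsub>M\<^esub> x \<ominus>\<^bsub>M\<^esub> [c] \<cdot>\<^bsub>M\<^esub> y"
  using assms by (simp add: add_pow_eq_smult a_minus_def smult_r_distr smult_r_minus)

lemma (in module) finsum_add_pow:
  assumes "finite S" "f \<in> S \<rightarrow> carrier M"
  shows "[(c :: int)] \<cdot>\<^bsub>M\<^esub> (\<Oplus>\<^bsub>M\<^esub>x\<in>S. f x) = (\<Oplus>\<^bsub>M\<^esub>x\<in>S. [c] \<cdot>\<^bsub>M\<^esub> f x)"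
proof -
  have "[c] \<cdot>\<^bsub>M\<^esub> (\<Oplus>\<^bsub>M\<^esub>x\<in>S. f x) = (\<Oplus>\<^bsub>M\<^esub>x\<in>S. ([c] \<cdot>\<^bsub>R\<^esub> \<one>\<^bsub>R\<^esub>) \<odot>\<^bsub>M\<^esub> f x)"
    using assms by (simp add: add_pow_eq_smult M.finsum_closed finsum_smult_ldistr)
  also have "\<dots> = (\<Oplus>\<^bsub>M\<^esub>x\<in>S. [c] \<cdot>\<^bsub>M\<^esub> f x)"
    using assms by (intro M.finsum_cong' refl) (auto simp: add_pow_eq_smult Pi_iff)
  finally show ?thesis .
qed

lemma (in module) finsum_uminus:
  assumes "finite S" "f \<in> S \<rightarrow> carrier M"
  shows "(\<Oplus>\<^bsub>M\<^esub>x\<in>S. \<ominus>\<^bsub>M\<^esub> f x) = \<ominus>\<^bsub>M\<^esub> (\<Oplus>\<^bsub>M\<^esub>x\<in>S. f x)"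
proof -
  have "(\<Oplus>\<^bsub>M\<^esub>x\<in>S. \<ominus>\<^bsub>M\<^esub> f x) = (\<Oplus>\<^bsub>M\<^esub>x\<in>S. [(-1 :: int)] \<cdot>\<^bsub>M\<^esub> f x)"
    using assms add_pow_minus_int[of _ 1] by (intro M.finsum_cong' refl) (auto simp: Pi_iff)
  also have "\<dots> = \<ominus>\<^bsub>M\<^esub> (\<Oplus>\<^bsub>M\<^esub>x\<in>S. f x)"
    using assms by (simp add: finsum_add_pow[symmetric] M.finsum_closed add_pow_minus_int[of _ 1, simplified])
  finally show ?thesis .
qed

lemma (in abelian_monoid) finsum_reindex_bij_betw:
  assumes "bij_betw h S T" "f \<in> T \<rightarrow> carrier G"
  shows "(\<Oplus>x\<in>S. f (h x)) = (\<Oplus>y\<in>T. f y)"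
  using assms add.finprod_reindex[of f h S] by (auto simp: bij_betw_def)

lemma (in abelian_monoid) finsum_Times:
  assumes "finite X" "finite Y" "\<And>x y. x \<in> X \<Longrightarrow> y \<in> Y \<Longrightarrow> f (x, y) \<in> carrier G"
  shows "(\<Oplus>x\<in>X. \<Oplus>y\<in>Y. f (x, y)) = (\<Oplus>z\<in>X \<times> Y. f z)"
  using assms(1,3)
proof (induction X rule: finite_induct)
  case (insert x X)
  have "(\<Oplus>z\<in>insert x X \<times> Y. f z) = (\<Oplus>z\<in>Pair x ` Y \<union> X \<times> Y. f z)"
    by (rule arg_cong[where f = "finsum G f"]) auto
  also have "\<dots> = (\<Oplus>z\<in>Pair x ` Y. f z) \<oplus> (\<Oplus>z\<in>X \<times> Y. f z)"
    by (rule finsum_Un_disjoint) (use insert assms(2) in auto)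
  also have "(\<Oplus>z\<in>Pair x ` Y. f z) = (\<Oplus>y\<in>Y. f (x, y))"
    by (rule finsum_reindex_bij_betw[symmetric]) (use insert in \<open>auto simp: bij_betw_def inj_on_def\<close>)
  also have "(\<Oplus>z\<in>X \<times> Y. f z) = (\<Oplus>x\<in>X. \<Oplus>y\<in>Y. f (x, y))"
    by (rule insert.IH[symmetric]) (use insert.prems in auto)
  finally show ?case
    using insert assms(2) by (subst finsum_insert) (auto intro!: finsum_closed)
qed simp

section \<open>Linear and multilinear maps\<close>

lemma linear_map_closed: "linear_map R M N h \<Longrightarrow> x \<in> carrier M \<Longrightarrow> h x \<in> carrier N"
  by (auto simp: linear_map_def)

lemma linear_map_add:
  "linear_map R M N h \<Longrightarrow> x \<in> carrier M \<Longrightarrow> y \<in> carrier M \<Longrightarrow> h (x \<oplus>\<^bsub>M\<^esub> y) = h x \<oplus>\<^bsub>N\<^esub> h y"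
  by (auto simp: linear_map_def)

lemma linear_map_smult:
  "linear_map R M N h \<Longrightarrow> r \<in> carrier R \<Longrightarrow> x \<in> carrier M \<Longrightarrow> h (r \<odot>\<^bsub>M\<^esub> x) = r \<odot>\<^bsub>N\<^esub> h x"
  by (auto simp: linear_map_def)

lemma linear_map_id: "module R M \<Longrightarrow> linear_map R M M (\<lambda>x. x)"
  by (simp add: linear_map_def)

lemma linear_map_compose:
  "linear_map R M N h \<Longrightarrow> linear_map R N P h' \<Longrightarrow> linear_map R M P (\<lambda>x. h' (h x))"
  unfolding linear_map_def by (auto simp: Pi_iff)

lemma linear_map_signed_sum:
  assumes h: "linear_map R M N h" and S: "finite S" "f \<in> S \<rightarrow> carrier M"
  shows "h (\<Oplus>\<^bsub>M\<^esub>x\<in>S. [(c x :: int)] \<cdot>\<^bsub>M\<^esub> f x) = (\<Oplus>\<^bsub>N\<^esub>x\<in>S. [(c x)] \<cdot>\<^bsub>N\<^esub> h (f x))"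
proof -
  interpret M: module R M using h by (simp add: linear_map_def)
  interpret N: module R N using h by (simp add: linear_map_def)
  have scalar: "[(d :: int)] \<cdot>\<^bsub>R\<^esub> \<one>\<^bsub>R\<^esub> \<in> carrier R" for d
    by (rule M.R.add.int_pow_closed) simp
  show ?thesis
    using S
  proof (induction S rule: finite_induct)
    case empty
    show ?case using linear_map_facts(2)[OF h] by simp
  next
    case (insert a S)
    have "h ([(c a)] \<cdot>\<^bsub>M\<^esub> f a) = [(c a)] \<cdot>\<^bsub>N\<^esub> h (f a)"
      using insert.prems linear_map_closed[OF h]
      by (simp add: M.add_pow_eq_smult N.add_pow_eq_smult linear_map_smult[OF h] scalar)
    then show ?case
      using insert linear_map_closed[OF h]
      by (subst M.M.finsum_insert; (subst N.M.finsum_insert)?)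
        (auto simp: linear_map_add[OF h] M.M.finsum_closed Pi_iff)
  qed
qed

lemma multilinear_signed_sum:
  assumes M: "module R M" and S: "finite S"
    and g: "\<And>\<sigma>. \<sigma> \<in> S \<Longrightarrow> multilinear R A n M (g \<sigma>)"
  shows "multilinear R A n M (\<lambda>xs. \<Oplus>\<^bsub>M\<^esub>\<sigma>\<in>S. [(c \<sigma> :: int)] \<cdot>\<^bsub>M\<^esub> g \<sigma> xs)"
proof -
  interpret M: module R M by fact
  have clo: "g \<sigma> xs \<in> carrier M" if "\<sigma> \<in> S" "xs \<in> tuples A n" for \<sigma> xs
    using g[OF that(1)] that(2) by (auto simp: multilinear_def)
  have scalar: "[(d :: int)] \<cdot>\<^bsub>R\<^esub> \<one>\<^bsub>R\<^esub> \<in> carrier R" for d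
    by (rule M.R.add.int_pow_closed) simp
  show ?thesis
    unfolding multilinear_def
  proof (intro conjI ballI allI impI)
    show "(\<lambda>xs. \<Oplus>\<^bsub>M\<^esub>\<sigma>\<in>S. [(c \<sigma>)] \<cdot>\<^bsub>M\<^esub> g \<sigma> xs) \<in> tuples A n \<rightarrow> carrier M"
      using clo by (auto intro!: M.M.finsum_closed)
  next
    fix xs i x y
    assume xs: "xs \<in> tuples A n" "i < n" and x: "x \<in> carrier A" and y: "y \<in> carrier A"
    note up = tuples_update[OF xs(1) x, of i] tuples_update[OF xs(1) y, of i]
    have "(\<Oplus>\<^bsub>M\<^esub>\<sigma>\<in>S. [(c \<sigma>)] \<cdot>\<^bsub>M\<^esub> g \<sigma> (xs[i := x \<oplus>\<^bsub>A\<^esub> y])) =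
        (\<Oplus>\<^bsub>M\<^esub>\<sigma>\<in>S. [(c \<sigma>)] \<cdot>\<^bsub>M\<^esub> g \<sigma> (xs[i := x]) \<oplus>\<^bsub>M\<^esub> [(c \<sigma>)] \<cdot>\<^bsub>M\<^esub> g \<sigma> (xs[i := y]))"
    proof (rule M.M.finsum_cong')
      fix \<sigma> assume \<sigma>: "\<sigma> \<in> S"
      then have "g \<sigma> (xs[i := x \<oplus>\<^bsub>A\<^esub> y]) = g \<sigma> (xs[i := x]) \<oplus>\<^bsub>M\<^esub> g \<sigma> (xs[i := y])"
        using g xs x y by (auto simp: multilinear_def)
      then show "[(c \<sigma>)] \<cdot>\<^bsub>M\<^esub> g \<sigma> (xs[i := x \<oplus>\<^bsub>A\<^esub> y]) =
          [(c \<sigma>)] \<cdot>\<^bsub>M\<^esub> g \<sigma> (xs[i := x]) \<oplus>\<^bsub>M\<^esub> [(c \<sigma>)] \<cdot>\<^bsub>M\<^esub> g \<sigma> (xs[i := y])"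
        using clo[OF \<sigma>] up by (simp add: M.add_pow_eq_smult scalar M.smult_r_distr)
    qed (use clo up in auto)
    also have "\<dots> = (\<Oplus>\<^bsub>M\<^esub>\<sigma>\<in>S. [(c \<sigma>)] \<cdot>\<^bsub>M\<^esub> g \<sigma> (xs[i := x])) \<oplus>\<^bsub>M\<^esub>
        (\<Oplus>\<^bsub>M\<^esub>\<sigma>\<in>S. [(c \<sigma>)] \<cdot>\<^bsub>M\<^esub> g \<sigma> (xs[i := y]))"
      by (rule M.M.finsum_addf) (use clo up in auto)
    finally show "(\<Oplus>\<^bsub>M\<^esub>\<sigma>\<in>S. [(c \<sigma>)] \<cdot>\<^bsub>M\<^esub> g \<sigma> (xs[i := x \<oplus>\<^bsub>A\<^esub> y])) = \<dots>" .
  next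
    fix xs i r x
    assume xs: "xs \<in> tuples A n" "i < n" and r: "r \<in> carrier R" and x: "x \<in> carrier A"
    note up = tuples_update[OF xs(1) x, of i]
    have "r \<odot>\<^bsub>M\<^esub> (\<Oplus>\<^bsub>M\<^esub>\<sigma>\<in>S. [(c \<sigma>)] \<cdot>\<^bsub>M\<^esub> g \<sigma> (xs[i := x])) =
        (\<Oplus>\<^bsub>M\<^esub>\<sigma>\<in>S. r \<odot>\<^bsub>M\<^esub> ([(c \<sigma>)] \<cdot>\<^bsub>M\<^esub> g \<sigma> (xs[i := x])))"
      by (rule M.finsum_smult_ldistr) (use S r clo up in auto)
    also have "\<dots> = (\<Oplus>\<^bsub>M\<^esub>\<sigma>\<in>S. [(c \<sigma>)] \<cdot>\<^bsub>M\<^esub> g \<sigma> (xs[i := r \<odot>\<^bsub>A\<^esub> x]))"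
    proof (rule M.M.finsum_cong')
      have e: "g \<sigma> (xs[i := r \<odot>\<^bsub>A\<^esub> x]) = r \<odot>\<^bsub>M\<^esub> g \<sigma> (xs[i := x])" if "\<sigma> \<in> S" for \<sigma>
        using g[OF that] xs x r by (auto simp: multilinear_def)
      show "r \<odot>\<^bsub>M\<^esub> ([(c \<sigma>)] \<cdot>\<^bsub>M\<^esub> g \<sigma> (xs[i := x])) = [(c \<sigma>)] \<cdot>\<^bsub>M\<^esub> g \<sigma> (xs[i := r \<odot>\<^bsub>A\<^esub> x])"
        if "\<sigma> \<in> S" for \<sigma>
        using clo[OF that up] r that
        by (simp add: e M.add_pow_eq_smult scalar M.smult_assoc1[symmetric] M.R.m_comm)
      show "(\<lambda>\<sigma>. [(c \<sigma>)] \<cdot>\<^bsub>M\<^esub> g \<sigma> (xs[i := r \<odot>\<^bsub>A\<^esub> x])) \<in> S \<rightarrow> carrier M"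
        using clo up r by (simp add: e)
    qed simp
    finally show "(\<Oplus>\<^bsub>M\<^esub>\<sigma>\<in>S. [(c \<sigma>)] \<cdot>\<^bsub>M\<^esub> g \<sigma> (xs[i := r \<odot>\<^bsub>A\<^esub> x])) =
        r \<odot>\<^bsub>M\<^esub> (\<Oplus>\<^bsub>M\<^esub>\<sigma>\<in>S. [(c \<sigma>)] \<cdot>\<^bsub>M\<^esub> g \<sigma> (xs[i := x]))" by simp
  qed
qed

text \<open>
  The relations divided out in the tensor power say exactly this.
\<close>

lemma multilinear_pure_tensor:
  assumes A: "module R A"
  shows "multilinear R A n (tensor_power R A n) (pure_tensor R A)"
proof -
  interpret A: module R A by fact
  let ?F = "free_module R (tuples A n)" and ?N = "tensor_null R A n" and ?e = "free_gen R"
  have F: "module R ?F" by (rule module_free_module[OF A.is_cring])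
  interpret F: module R ?F by fact
  note q = quotient_module_facts[OF F tensor_null_submodule[OF A], folded tensor_power_def]
  have pure: "pure_tensor R A xs = ?N +>\<^bsub>?F\<^esub> ?e xs" if "xs \<in> tuples A n" for xs
    using that by (simp add: pure_tensor_def tuples_def)
  have e: "?e xs \<in> carrier ?F" if "xs \<in> tuples A n" for xs
    by (rule free_gen_closed[OF A.is_cring that])
  have rel: "tensor_relations R A n \<subseteq> ?N"
    unfolding tensor_null_def submodule_span_def by blast
  show ?thesis
    unfolding multilinear_def
  proof (intro conjI ballI allI impI)
    show "pure_tensor R A \<in> tuples A n \<rightarrow> carrier (tensor_power R A n)"
      using pure_tensor_closed[OF A] by blast
  next
    fix xs i x y
    assume xs: "xs \<in> tuples A n" "i < n" and x: "x \<in> carrier A" and y: "y \<in> carrier A"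
    have "?e (xs[i := x \<oplus>\<^bsub>A\<^esub> y]) \<ominus>\<^bsub>?F\<^esub> (?e (xs[i := x]) \<oplus>\<^bsub>?F\<^esub> ?e (xs[i := y])) \<in> tensor_relations R A n"
      unfolding tensor_relations_def Let_def using xs x y by blast
    then show "pure_tensor R A (xs[i := x \<oplus>\<^bsub>A\<^esub> y]) =
        pure_tensor R A (xs[i := x]) \<oplus>\<^bsub>tensor_power R A n\<^esub> pure_tensor R A (xs[i := y])"
      using rel xs x y by (simp add: pure tuples_update e q(3) q(6) subset_iff)
  next
    fix xs i r x
    assume xs: "xs \<in> tuples A n" "i < n" and r: "r \<in> carrier R" and x: "x \<in> carrier A"
    have "?e (xs[i := r \<odot>\<^bsub>A\<^esub> x]) \<ominus>\<^bsub>?F\<^esub> (r \<odot>\<^bsub>?F\<^esub> ?e (xs[i := x])) \<in> tensor_relations R A n"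
      unfolding tensor_relations_def Let_def using xs r x by blast
    then show "pure_tensor R A (xs[i := r \<odot>\<^bsub>A\<^esub> x]) =
        r \<odot>\<^bsub>tensor_power R A n\<^esub> pure_tensor R A (xs[i := x])"
      using rel xs r x by (simp add: pure tuples_update e q(4) q(6) subset_iff)
  qed
qed

section \<open>Multilinear substitutions and the maps they induce on tensor powers\<close>

text \<open>
  The list operations behind the differentials, the antisymmetrization and the maps induced by
  algebra homomorphisms all have this property: they place each entry of the given list at exactly
  one position, through a linear map that may depend on the remaining entries. The property is
  preserved by composition, and it transports multilinear maps.
\<close>

definition entrywise_linear ::
  "('k, 'r) ring_scheme \<Rightarrow> ('k, 'a, 'm) module_scheme \<Rightarrow> nat \<Rightarrow> ('k, 'b, 'n) module_scheme \<Rightarrow> nat \<Rightarrow>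
    ('a list \<Rightarrow> 'b list) \<Rightarrow> bool"
  where "entrywise_linear R A m B n op \<longleftrightarrow>
    (\<forall>xs\<in>tuples A m. op xs \<in> tuples B n \<and>
      (\<forall>i<m. \<exists>j<n. \<exists>h. linear_map R A B h \<and>
        (\<forall>x\<in>carrier A. op (xs[i := x]) = (op xs)[j := h x])))"

lemma entrywise_linear_tuples:
  "entrywise_linear R A m B n op \<Longrightarrow> xs \<in> tuples A m \<Longrightarrow> op xs \<in> tuples B n"
  by (simp add: entrywise_linear_def)

lemma entrywise_linearE:
  assumes "entrywise_linear R A m B n op" "xs \<in> tuples A m" "i < m"
  obtains j h where "j < n" "linear_map R A B h"
    "\<And>x. x \<in> carrier A \<Longrightarrow> op (xs[i := x]) = (op xs)[j := h x]"
  using assms unfolding entrywise_linear_def by meson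

lemma entrywise_linear_compose:
  assumes op: "entrywise_linear R A m B n op" and op': "entrywise_linear R B n C p op'"
  shows "entrywise_linear R A m C p (\<lambda>xs. op' (op xs))"
  unfolding entrywise_linear_def
proof (intro ballI conjI allI impI)
  fix xs assume xs: "xs \<in> tuples A m"
  note ys = entrywise_linear_tuples[OF op xs]
  show "op' (op xs) \<in> tuples C p"
    by (rule entrywise_linear_tuples[OF op' ys])
  fix i assume "i < m"
  then obtain j h where jh: "j < n" "linear_map R A B h"
      "\<And>x. x \<in> carrier A \<Longrightarrow> op (xs[i := x]) = (op xs)[j := h x]"
    using entrywise_linearE[OF op xs] by metis
  obtain l h' where lh: "l < p" "linear_map R B C h'"
      "\<And>y. y \<in> carrier B \<Longrightarrow> op' ((op xs)[j := y]) = (op' (op xs))[l := h' y]"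
    using entrywise_linearE[OF op' ys jh(1)] by metis
  show "\<exists>l<p. \<exists>h. linear_map R A C h \<and>
      (\<forall>x\<in>carrier A. op' (op (xs[i := x])) = (op' (op xs))[l := h x])"
    using jh lh linear_map_compose[OF jh(2) lh(2)] linear_map_closed[OF jh(2)] by auto
qed

lemma multilinear_compose:
  assumes g: "multilinear R B n M g" and op: "entrywise_linear R A m B n op"
  shows "multilinear R A m M (\<lambda>xs. g (op xs))"
  unfolding multilinear_def
proof (intro conjI ballI allI impI)
  show "(\<lambda>xs. g (op xs)) \<in> tuples A m \<rightarrow> carrier M"
    using g entrywise_linear_tuples[OF op] by (auto simp: multilinear_def)
next
  fix xs i x y assume xs: "xs \<in> tuples A m" "i < m" and x: "x \<in> carrier A" and y: "y \<in> carrier A"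
  obtain j h where jh: "j < n" "linear_map R A B h"
      "\<And>x. x \<in> carrier A \<Longrightarrow> op (xs[i := x]) = (op xs)[j := h x]"
    using entrywise_linearE[OF op xs] by metis
  interpret A: module R A using jh(2) by (simp add: linear_map_def)
  show "g (op (xs[i := x \<oplus>\<^bsub>A\<^esub> y])) = g (op (xs[i := x])) \<oplus>\<^bsub>M\<^esub> g (op (xs[i := y]))"
    using g entrywise_linear_tuples[OF op xs(1)] jh x y
    by (simp add: multilinear_def linear_map_add[OF jh(2)] linear_map_closed[OF jh(2)])
next
  fix xs i r x assume xs: "xs \<in> tuples A m" "i < m" and r: "r \<in> carrier R" and x: "x \<in> carrier A"
  obtain j h where jh: "j < n" "linear_map R A B h"
      "\<And>x. x \<in> carrier A \<Longrightarrow> op (xs[i := x]) = (op xs)[j := h x]"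
    using entrywise_linearE[OF op xs] by metis
  interpret A: module R A using jh(2) by (simp add: linear_map_def)
  show "g (op (xs[i := r \<odot>\<^bsub>A\<^esub> x])) = r \<odot>\<^bsub>M\<^esub> g (op (xs[i := x]))"
    using g entrywise_linear_tuples[OF op xs(1)] jh x r
    by (simp add: multilinear_def linear_map_smult[OF jh(2)] linear_map_closed[OF jh(2)])
qed

lemma tensor_lift_signed_sum:
  fixes c :: "'s \<Rightarrow> int"
  assumes A: "module R A" and S: "finite S"
    and op: "\<And>\<sigma>. \<sigma> \<in> S \<Longrightarrow> entrywise_linear R A m A n (op \<sigma>)"
  defines "g \<equiv> \<lambda>xs. \<Oplus>\<^bsub>tensor_power R A n\<^esub>\<sigma>\<in>S. [c \<sigma>] \<cdot>\<^bsub>tensor_power R A n\<^esub> pure_tensor R A (op \<sigma> xs)"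
  shows "linear_map R (tensor_power R A m) (tensor_power R A n) (tensor_lift R A m (tensor_power R A n) g)"
    and "xs \<in> tuples A m \<Longrightarrow> tensor_lift R A m (tensor_power R A n) g (pure_tensor R A xs) = g xs"
proof -
  have T: "module R (tensor_power R A n)" by (rule module_tensor_power[OF A])
  have "multilinear R A m (tensor_power R A n) g"
    unfolding g_def
    by (intro multilinear_signed_sum T S multilinear_compose[OF multilinear_pure_tensor[OF A]] op)
  note tensor_lift[OF A T this]
  then show "linear_map R (tensor_power R A m) (tensor_power R A n) (tensor_lift R A m (tensor_power R A n) g)"
    and "xs \<in> tuples A m \<Longrightarrow> tensor_lift R A m (tensor_power R A n) g (pure_tensor R A xs) = g xs"
    by blast+
qed

lemma entrywise_linear_map:
  assumes f: "linear_map R A B f"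
  shows "entrywise_linear R A n B n (map f)"
  unfolding entrywise_linear_def
  using f linear_map_closed[OF f] by (auto simp: tuples_def map_update)

lemma tensor_power_map_facts:
  assumes f: "linear_map R A B f"
  shows "linear_map R (tensor_power R A n) (tensor_power R B n) (tensor_power_map R A B f n)"
    and "xs \<in> tuples A n \<Longrightarrow>
      tensor_power_map R A B f n (pure_tensor R A xs) = pure_tensor R B (map f xs)"
proof -
  have A: "module R A" and B: "module R B" using f by (auto simp: linear_map_def)
  have "multilinear R A n (tensor_power R B n) (\<lambda>xs. pure_tensor R B (map f xs))"
    by (rule multilinear_compose[OF multilinear_pure_tensor[OF B] entrywise_linear_map[OF f]])
  note tensor_lift[OF A module_tensor_power[OF B] this, folded tensor_power_map_def]
  then show "linear_map R (tensor_power R A n) (tensor_power R B n) (tensor_power_map R A B f n)"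
    and "xs \<in> tuples A n \<Longrightarrow>
      tensor_power_map R A B f n (pure_tensor R A xs) = pure_tensor R B (map f xs)"
    by blast+
qed

text \<open>
  Two linear maps on a tensor power agree once they agree on pure tensors, so naturality reduces to
  the compatibility of the list operations with applying \<open>f\<close> to every entry.
\<close>

lemma tensor_lift_signed_sum_natural:
  assumes f: "linear_map R A B f" and S: "finite S"
    and opA: "\<And>\<sigma>. \<sigma> \<in> S \<Longrightarrow> entrywise_linear R A m A n (opA \<sigma>)"
    and opB: "\<And>\<sigma>. \<sigma> \<in> S \<Longrightarrow> entrywise_linear R B m B n (opB \<sigma>)"
    and nat: "\<And>\<sigma> xs. \<sigma> \<in> S \<Longrightarrow> xs \<in> tuples A m \<Longrightarrow> opB \<sigma> (map f xs) = map f (opA \<sigma> xs)"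
    and X: "X \<in> carrier (tensor_power R A m)"
  shows "tensor_power_map R A B f n (tensor_lift R A m (tensor_power R A n)
        (\<lambda>xs. \<Oplus>\<^bsub>tensor_power R A n\<^esub>\<sigma>\<in>S. [(c \<sigma> :: int)] \<cdot>\<^bsub>tensor_power R A n\<^esub> pure_tensor R A (opA \<sigma> xs)) X) =
      tensor_lift R B m (tensor_power R B n)
        (\<lambda>xs. \<Oplus>\<^bsub>tensor_power R B n\<^esub>\<sigma>\<in>S. [(c \<sigma> :: int)] \<cdot>\<^bsub>tensor_power R B n\<^esub> pure_tensor R B (opB \<sigma> xs))
        (tensor_power_map R A B f m X)"
proof -
  let ?f = "tensor_power_map R A B f n" and ?f' = "tensor_power_map R A B f m"
  let ?dA = "tensor_lift R A m (tensor_power R A n)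
    (\<lambda>xs. \<Oplus>\<^bsub>tensor_power R A n\<^esub>\<sigma>\<in>S. [(c \<sigma>)] \<cdot>\<^bsub>tensor_power R A n\<^esub> pure_tensor R A (opA \<sigma> xs))"
  let ?dB = "tensor_lift R B m (tensor_power R B n)
    (\<lambda>xs. \<Oplus>\<^bsub>tensor_power R B n\<^esub>\<sigma>\<in>S. [(c \<sigma>)] \<cdot>\<^bsub>tensor_power R B n\<^esub> pure_tensor R B (opB \<sigma> xs))"
  have A: "module R A" using f by (simp add: linear_map_def)
  have B: "module R B" using f by (simp add: linear_map_def)
  note dA = tensor_lift_signed_sum[OF A S opA, where c = c]
  note dB = tensor_lift_signed_sum[OF B S opB, where c = c]
  note F = tensor_power_map_facts[OF f]
  have lin: "linear_map R (tensor_power R A m) (tensor_power R B n) (\<lambda>X. ?f (?dA X))"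
    by (rule linear_map_compose[OF dA(1) F(1)]) simp
  have lin': "linear_map R (tensor_power R A m) (tensor_power R B n) (\<lambda>X. ?dB (?f' X))"
    by (rule linear_map_compose[OF F(1) dB(1)]) simp
  have gen: "?f (?dA (pure_tensor R A xs)) = ?dB (?f' (pure_tensor R A xs))" if xs: "xs \<in> tuples A m" for xs
  proof -
    have op: "opA \<sigma> xs \<in> tuples A n" if "\<sigma> \<in> S" for \<sigma>
      by (rule entrywise_linear_tuples[OF opA[OF that] xs])
    interpret TB: module R "tensor_power R B n" by (rule module_tensor_power[OF B])
    have "?dA (pure_tensor R A xs) = (\<Oplus>\<^bsub>tensor_power R A n\<^esub>\<sigma>\<in>S.
        [(c \<sigma>)] \<cdot>\<^bsub>tensor_power R A n\<^esub> pure_tensor R A (opA \<sigma> xs))"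
      by (rule dA(2)[OF _ xs])
    then have "?f (?dA (pure_tensor R A xs)) =
        (\<Oplus>\<^bsub>tensor_power R B n\<^esub>\<sigma>\<in>S. [(c \<sigma>)] \<cdot>\<^bsub>tensor_power R B n\<^esub> ?f (pure_tensor R A (opA \<sigma> xs)))"
      using linear_map_signed_sum[OF F(1) S, where f = "\<lambda>\<sigma>. pure_tensor R A (opA \<sigma> xs)" and c = c] op pure_tensor_closed[OF A]
      by (simp add: Pi_iff)
    also have "\<dots> = (\<Oplus>\<^bsub>tensor_power R B n\<^esub>\<sigma>\<in>S. [(c \<sigma>)] \<cdot>\<^bsub>tensor_power R B n\<^esub> pure_tensor R B (opB \<sigma> (map f xs)))"
      using op nat xs pure_tensor_closed[OF B] entrywise_linear_tuples[OF entrywise_linear_map[OF f]]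
      by (intro TB.M.finsum_cong' refl) (auto simp: F(2))
    also have "\<dots> = ?dB (?f' (pure_tensor R A xs))"
      by (simp add: F(2)[OF xs] dB(2) entrywise_linear_tuples[OF entrywise_linear_map[OF f] xs])
    finally show ?thesis .
  qed
  show ?thesis
    by (rule linear_map_eqI_pure_tensor[OF A lin lin' gen X])
qed

section \<open>Merging two entries of a tensor\<close>

lemma entrywise_linear_permute_list:
  assumes A: "module R A" and s: "s permutes {..<n}"
  shows "entrywise_linear R A n A n (permute_list s)"
  unfolding entrywise_linear_def
proof (intro ballI conjI allI impI)
  fix xs assume xs: "xs \<in> tuples A n"
  then show "permute_list s xs \<in> tuples A n"
    using s by (auto simp: tuples_def)
  fix i assume i: "i < n"
  have j: "Hilbert_Choice.inv s i < n"
    using permutes_in_image[OF permutes_inv[OF s], of i] i by simp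
  have "permute_list s (xs[i := x]) = (permute_list s xs)[Hilbert_Choice.inv s i := x]" for x
  proof (rule nth_equalityI)
    fix l assume "l < length (permute_list s (xs[i := x]))"
    then have l: "l < n" using xs by (simp add: tuples_def)
    have "s l < n" using permutes_in_image[OF s, of l] l by simp
    moreover have "s l = i \<longleftrightarrow> l = Hilbert_Choice.inv s i"
      using permutes_inv_eq[OF s] by metis
    ultimately show "permute_list s (xs[i := x]) ! l = (permute_list s xs)[Hilbert_Choice.inv s i := x] ! l"
      using l xs s by (auto simp: tuples_def permute_list_nth nth_list_update)
  qed simp
  then show "\<exists>j<n. \<exists>h. linear_map R A A h \<and>
      (\<forall>x\<in>carrier A. permute_list s (xs[i := x]) = (permute_list s xs)[j := h x])"
    using j linear_map_id[OF A] by blast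
qed

definition bilinear ::
  "('k, 'r) ring_scheme \<Rightarrow> ('k, 'a, 'm) module_scheme \<Rightarrow> ('a \<Rightarrow> 'a \<Rightarrow> 'a) \<Rightarrow> bool"
  where "bilinear R A \<mu> \<longleftrightarrow>
    (\<forall>a\<in>carrier A. linear_map R A A (\<lambda>x. \<mu> a x) \<and> linear_map R A A (\<lambda>x. \<mu> x a))"

text \<open>
  Every summand of both differentials arises by moving one entry to the end, unless it is there
  already, and then absorbing it into another entry by a bilinear operation. Keeping the absorbed entry in last position is what
  makes the operation compatible with permutations of the remaining entries.
\<close>

definition absorb_last :: "('a \<Rightarrow> 'a \<Rightarrow> 'a) \<Rightarrow> nat \<Rightarrow> 'a list \<Rightarrow> 'a list"
  where "absorb_last \<mu> i xs = (butlast xs)[i := \<mu> (xs ! i) (last xs)]"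

lemma length_absorb_last [simp]: "length (absorb_last \<mu> i xs) = length xs - 1"
  by (simp add: absorb_last_def)

lemma nth_absorb_last:
  "length xs = Suc n \<Longrightarrow> l < n \<Longrightarrow>
    absorb_last \<mu> i xs ! l = (if l = i then \<mu> (xs ! i) (xs ! n) else xs ! l)"
  by (cases xs rule: rev_cases) (auto simp: absorb_last_def nth_list_update nth_append)

lemma entrywise_linear_absorb_last:
  assumes A: "module R A" and \<mu>: "bilinear R A \<mu>" and i: "i < n"
  shows "entrywise_linear R A (Suc n) A n (absorb_last \<mu> i)"
  unfolding entrywise_linear_def
proof (intro ballI conjI allI impI)
  fix xs assume xs: "xs \<in> tuples A (Suc n)"
  then have len: "length xs = Suc n" and clo: "\<And>l. l < Suc n \<Longrightarrow> xs ! l \<in> carrier A"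
    by (auto simp: tuples_def subset_iff)
  have \<mu>_closed: "\<mu> (xs ! i) (xs ! n) \<in> carrier A"
    using \<mu> clo i linear_map_closed[of R A A "\<lambda>x. \<mu> (xs ! i) x" "xs ! n"] by (simp add: bilinear_def)
  show "absorb_last \<mu> i xs \<in> tuples A n"
    using len clo \<mu>_closed nth_absorb_last[OF len, of _ \<mu> i]
    by (auto simp: tuples_def in_set_conv_nth)
  fix l assume l: "l < Suc n"
  have "\<exists>h. linear_map R A A h \<and>
      (\<forall>x\<in>carrier A. absorb_last \<mu> i (xs[l := x]) = (absorb_last \<mu> i xs)[if l = n then i else l := h x])"
  proof -
    define h where "h = (if l = n then \<mu> (xs ! i) else if l = i then (\<lambda>x. \<mu> x (xs ! n)) else (\<lambda>x. x))"
    have "linear_map R A A h"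
      using \<mu> clo i linear_map_id[OF A] by (auto simp: h_def bilinear_def)
    moreover have "absorb_last \<mu> i (xs[l := x]) = (absorb_last \<mu> i xs)[if l = n then i else l := h x]" for x
      by (rule nth_equalityI)
        (use len i l in \<open>auto simp: nth_absorb_last[where n = n] nth_list_update h_def\<close>)
    ultimately show ?thesis by blast
  qed
  then show "\<exists>j<n. \<exists>h. linear_map R A A h \<and>
      (\<forall>x\<in>carrier A. absorb_last \<mu> i (xs[l := x]) = (absorb_last \<mu> i xs)[j := h x])"
    using l i by (intro exI[of _ "if l = n then i else l"]) auto
qed

lemma permute_list_absorb_last:
  assumes t: "t permutes {..<n}" and len: "length xs = Suc n" and i: "i < n"
  shows "permute_list t (absorb_last \<mu> i xs) =
    absorb_last \<mu> (Hilbert_Choice.inv t i) (permute_list t xs)"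
proof (rule nth_equalityI)
  have t': "t permutes {..<Suc n}" by (rule permutes_subset[OF t]) auto
  have tn: "t n = n" using permutes_not_in[OF t, of n] by simp
  have it: "Hilbert_Choice.inv t i < n" "t (Hilbert_Choice.inv t i) = i"
    using permutes_in_image[OF permutes_inv[OF t], of i] i permutes_inverses[OF t] by auto
  fix l assume "l < length (permute_list t (absorb_last \<mu> i xs))"
  then have l: "l < n" using len by simp
  have tl: "t l < n" using permutes_in_image[OF t, of l] l by simp
  have "t l = i \<longleftrightarrow> l = Hilbert_Choice.inv t i"
    using permutes_inv_eq[OF t] by metis
  then show "permute_list t (absorb_last \<mu> i xs) ! l =
      absorb_last \<mu> (Hilbert_Choice.inv t i) (permute_list t xs) ! l"
    using l tl it tn t t' len by (auto simp: permute_list_nth nth_absorb_last[where n = n])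
qed (use len in simp)

text \<open>
  The cycle on \<open>{k..n}\<close> through which \<^const>\<open>permute_list\<close> takes the entry at position \<open>k\<close> out and
  puts it at the end, at position \<open>n\<close>.
\<close>

definition move_to_end :: "nat \<Rightarrow> nat \<Rightarrow> nat \<Rightarrow> nat"
  where "move_to_end n k l = (if l = n then k else if k \<le> l \<and> l < n then Suc l else l)"

lemma move_to_end_permutes_sign:
  "k \<le> n \<Longrightarrow> move_to_end n k permutes {k..n} \<and> sign (move_to_end n k) = (-1) ^ (n - k)"
proof (induction k rule: inc_induct)
  case base
  have "move_to_end n n = id" by (auto simp: move_to_end_def)
  then show ?case by (simp add: permutes_id id_def[symmetric])
next
  case (step k)
  have eq: "move_to_end n k = transpose k (Suc k) \<circ> move_to_end n (Suc k)"
    using step.hyps by (auto simp: fun_eq_iff move_to_end_def transpose_def)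
  have p: "move_to_end n (Suc k) permutes {k..n}"
    by (rule permutes_subset[OF conjunct1[OF step.IH]]) auto
  have q: "transpose k (Suc k) permutes {k..n}"
    by (rule permutes_swap_id) (use step.hyps in auto)
  have "sign (move_to_end n k) = - ((-1) ^ (n - Suc k))"
    using step.IH by (simp add: eq sign_compose permutation_swap_id permutes_imp_permutation[OF _ p] sign_swap_id)
  also have "\<dots> = (-1) ^ (n - k)"
    using step.hyps by (simp add: Suc_diff_Suc[symmetric])
  finally show ?case
    using permutes_compose[OF p q] unfolding eq by blast
qed

lemma move_to_end_permutes: "k \<le> n \<Longrightarrow> move_to_end n k permutes {k..n}"
  using move_to_end_permutes_sign by blast

lemma sign_move_to_end: "k \<le> n \<Longrightarrow> sign (move_to_end n k) = (-1) ^ (n - k)"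
  using move_to_end_permutes_sign by blast

lemma nth_permute_move_to_end:
  assumes "length xs = Suc n" "k \<le> n" "l \<le> n"
  shows "permute_list (move_to_end n k) xs ! l = (if l = n then xs ! k else if k \<le> l then xs ! Suc l else xs ! l)"
proof -
  have "move_to_end n k permutes {..<Suc n}"
    by (rule permutes_subset[OF move_to_end_permutes[OF assms(2)]]) auto
  then show ?thesis
    using assms by (simp add: permute_list_nth move_to_end_def)
qed

lemma hochschild_face_eq:
  assumes len: "length xs = Suc n" and i: "i < n"
  shows "hochschild_face A n i xs =
    absorb_last (\<otimes>\<^bsub>A\<^esub>) i (permute_list (move_to_end n (Suc i)) xs)"
proof (rule nth_equalityI)
  fix l assume "l < length (hochschild_face A n i xs)"
  then have l: "l < n" using assms by (simp add: hochschild_face_def)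
  then show "hochschild_face A n i xs ! l =
      absorb_last (\<otimes>\<^bsub>A\<^esub>) i (permute_list (move_to_end n (Suc i)) xs) ! l"
    using assms
    by (auto simp: hochschild_face_def nth_absorb_last[where n = n] nth_permute_move_to_end
        nth_append nth_Cons' min_def Suc_diff_Suc)
qed (use assms in \<open>simp add: hochschild_face_def\<close>)

lemma hochschild_last_face_eq:
  assumes len: "length xs = Suc n" and n: "0 < n"
  shows "hochschild_face A n n xs = absorb_last (\<lambda>x y. y \<otimes>\<^bsub>A\<^esub> x) 0 xs"
proof (rule nth_equalityI)
  fix l assume "l < length (hochschild_face A n n xs)"
  then have l: "l < n" using assms by (simp add: hochschild_face_def)
  then show "hochschild_face A n n xs ! l = absorb_last (\<lambda>x y. y \<otimes>\<^bsub>A\<^esub> x) 0 xs ! l"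
    using assms by (auto simp: hochschild_face_def nth_absorb_last[where n = n] nth_Cons')
qed (use assms in \<open>simp add: hochschild_face_def\<close>)

lemma leibniz_term_eq:
  assumes len: "length xs = Suc n" and i: "i < j" "j \<le> n"
  shows "take j (xs[i := \<mu> (xs ! i) (xs ! j)]) @ drop (Suc j) xs =
    absorb_last \<mu> i (permute_list (move_to_end n j) xs)"
proof (rule nth_equalityI)
  fix l assume "l < length (take j (xs[i := \<mu> (xs ! i) (xs ! j)]) @ drop (Suc j) xs)"
  then have l: "l < n" using assms by simp
  then show "(take j (xs[i := \<mu> (xs ! i) (xs ! j)]) @ drop (Suc j) xs) ! l =
      absorb_last \<mu> i (permute_list (move_to_end n j) xs) ! l"
    using assms
    by (auto simp: nth_absorb_last[where n = n] nth_permute_move_to_end nth_append nth_list_update)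
qed (use assms in simp)

lemma antisymmetrization_term_eq:
  assumes len: "length xs = Suc n" and s: "s permutes {1..n}"
  shows "xs ! 0 # map (\<lambda>i. xs ! s i) [1..<Suc n] = permute_list s xs"
proof -
  have "s 0 = 0" using permutes_not_in[OF s, of 0] by simp
  moreover have "[0..<Suc n] = 0 # [1..<Suc n]" by (simp add: upt_conv_Cons del: upt_Suc)
  ultimately show ?thesis by (simp add: permute_list_def len del: upt_Suc)
qed

section \<open>The summation identity behind the chain map property\<close>

lemma absorb_last_transpose:
  assumes "length xs = Suc n" "i < n"
  shows "absorb_last \<mu> i (permute_list (transpose i n) xs) = absorb_last (\<lambda>x y. \<mu> y x) i xs"
proof -
  have p: "transpose i n permutes {..<length xs}"
    by (rule permutes_swap_id) (use assms in auto)
  show ?thesis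
    by (rule nth_equalityI)
      (use assms p in \<open>auto simp: nth_absorb_last[where n = n] permute_list_nth transpose_def\<close>)
qed

lemma multilinear_minus:
  assumes A: "module R A" and M: "module R M" and g: "multilinear R A n M g"
    and xs: "xs \<in> tuples A n" "i < n" and x: "x \<in> carrier A" and y: "y \<in> carrier A"
  shows "g (xs[i := x \<ominus>\<^bsub>A\<^esub> y]) = g (xs[i := x]) \<ominus>\<^bsub>M\<^esub> g (xs[i := y])"
proof -
  interpret A: module R A by fact
  interpret M: module R M by fact
  have c: "g (xs[i := z]) \<in> carrier M" if "z \<in> carrier A" for z
    using g tuples_update[OF xs(1) that] by (auto simp: multilinear_def)
  have "(x \<ominus>\<^bsub>A\<^esub> y) \<oplus>\<^bsub>A\<^esub> y = x"
    using x y by (simp add: a_minus_def A.M.a_assoc A.M.l_neg)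
  then have "g (xs[i := x]) = g (xs[i := x \<ominus>\<^bsub>A\<^esub> y]) \<oplus>\<^bsub>M\<^esub> g (xs[i := y])"
    using g xs x y by (metis (no_types, lifting) A.M.minus_closed multilinear_def)
  then show ?thesis
    using c x y by (simp add: a_minus_def M.M.a_assoc M.M.r_neg)
qed

lemma bilinear_flip: "bilinear R A \<mu> \<Longrightarrow> bilinear R A (\<lambda>x y. \<mu> y x)"
  by (auto simp: bilinear_def)

context assoc_algebra
begin

lemma bilinear_mult: "bilinear R A (\<otimes>\<^bsub>A\<^esub>)"
  using module_axioms
  by (auto simp: bilinear_def linear_map_def alg_mult_closed alg_mult_distl alg_mult_distr
      alg_smult_multl alg_smult_multr)

lemma bilinear_commutator: "bilinear R A (commutator A)"
  using module_axioms
  by (auto simp: bilinear_def linear_map_def commutator_def alg_mult_closed alg_mult_distl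
      alg_mult_distr alg_smult_multl alg_smult_multr a_minus_def smult_r_distr smult_r_minus
      M.minus_add M.a_ac)

end

text \<open>
  The identity holds for every multilinear map \<open>g\<close> in place of the formation of pure tensors, and it
  is stated for one fixed tensor \<open>xs\<close> with entries numbered from \<open>0\<close> to \<open>N\<close>.
\<close>

locale merged_tensors = assoc_algebra R A + T: module R M
  for R (structure) and A (structure) and M (structure) +
  fixes n N :: nat and g :: "'b list \<Rightarrow> 'c" and xs :: "'b list"
  assumes g: "multilinear R A N M g" and xs: "xs \<in> tuples A (Suc N)" and N: "N = Suc n"
begin

text \<open>
  The common shape of the summands of \<open>b \<phi>\<close> and \<open>\<phi> d\<close>. The sign is the one that the summand has in
  either composite, except that the last face contributes the negative.
\<close>

definition merged :: "('b \<Rightarrow> 'b \<Rightarrow> 'b) \<Rightarrow> (nat \<Rightarrow> nat) \<times> nat \<Rightarrow> 'c"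
  where "merged \<mu> z = (case z of (D, i) \<Rightarrow>
    [((-1) ^ n * sign D)] \<cdot>\<^bsub>M\<^esub> g (absorb_last \<mu> i (permute_list D xs)))"

definition Perms :: "(nat \<Rightarrow> nat) set"
  where "Perms = {s. s permutes {1..N}}"

lemma length_xs: "length xs = Suc N"
  using xs by (simp add: tuples_def)

lemma finite_Perms: "finite Perms"
  by (simp add: Perms_def finite_permutations)

lemma PermsD:
  assumes "s \<in> Perms"
  shows "s permutes {..<Suc N}" "s 0 = 0" "permutation s" "s i = s j \<longleftrightarrow> i = j"
    "i \<le> N \<Longrightarrow> s i \<le> N"
proof -
  have s: "s permutes {1..N}" using assms by (simp add: Perms_def)
  show s': "s permutes {..<Suc N}" by (rule permutes_subset[OF s]) auto
  show "s 0 = 0" using permutes_not_in[OF s, of 0] by simp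
  show "permutation s" using permutes_imp_permutation[OF _ s] by simp
  show "s i = s j \<longleftrightarrow> i = j" using permutes_inj[OF s] by (auto dest: injD)
  show "i \<le> N \<Longrightarrow> s i \<le> N" using permutes_in_image[OF s', of i] by simp
qed

lemma absorb_permute_tuples:
  assumes "bilinear R A \<mu>" "s permutes {..<Suc N}" "i < N"
  shows "absorb_last \<mu> i (permute_list s xs) \<in> tuples A N"
  using entrywise_linear_tuples[OF entrywise_linear_compose[OF
    entrywise_linear_permute_list[OF module_axioms assms(2)]
    entrywise_linear_absorb_last[OF module_axioms assms(1,3)]] xs] .

lemma g_closed: "zs \<in> tuples A N \<Longrightarrow> g zs \<in> carrier M"
  using g by (auto simp: multilinear_def)

lemma merged_closed:
  "bilinear R A \<mu> \<Longrightarrow> z \<in> Perms \<times> {..<N} \<Longrightarrow> merged \<mu> z \<in> carrier M"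
  by (auto simp: merged_def intro!: T.sign_smult_closed g_closed absorb_permute_tuples PermsD(1))

abbreviation "mult_op \<equiv> (\<otimes>\<^bsub>A\<^esub>)"
abbreviation "flip_op \<equiv> (\<lambda>x y. y \<otimes>\<^bsub>A\<^esub> x)"

lemmas closed_mult = merged_closed[OF bilinear_mult]
lemmas closed_flip = merged_closed[OF bilinear_flip[OF bilinear_mult]]
lemmas closed_comm = merged_closed[OF bilinear_commutator]

text \<open>
  The pairs whose merged entries come from positions \<open>D i < D N\<close> of \<open>xs\<close>; these index the summands
  of \<open>\<phi> d\<close>, where only brackets \<open>[a\<^sub>p, a\<^sub>q]\<close> with \<open>p < q\<close> occur.
\<close>

definition Increasing :: "((nat \<Rightarrow> nat) \<times> nat) set"
  where "Increasing = {(D, i) \<in> Perms \<times> {..<N}. D i < D N}"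

lemma merged_commutator:
  assumes z: "z \<in> Perms \<times> {..<N}"
  shows "merged (commutator A) z = merged mult_op z \<ominus>\<^bsub>M\<^esub> merged flip_op z"
proof -
  obtain D i where Di: "z = (D, i)" "D \<in> Perms" "i < N" using z by auto
  let ?ys = "permute_list D xs"
  note D = PermsD(1)[OF Di(2)]
  have ys: "?ys \<in> tuples A (Suc N)"
    by (rule entrywise_linear_tuples[OF entrywise_linear_permute_list[OF module_axioms D] xs])
  then have "length ?ys = Suc N" by (simp add: tuples_def)
  then have ne: "?ys \<noteq> []" by (metis list.size(3) nat.distinct(1))
  have "?ys ! i \<in> carrier A" "last ?ys \<in> carrier A" "butlast ?ys \<in> tuples A N"
    using Di(3) last_in_set[OF ne] ys by (auto simp: tuples_def subset_iff in_set_butlastD)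
  then have "g (absorb_last (commutator A) i ?ys) =
      g (absorb_last mult_op i ?ys) \<ominus>\<^bsub>M\<^esub> g (absorb_last flip_op i ?ys)"
    unfolding absorb_last_def commutator_def
    by (intro multilinear_minus[OF module_axioms T.module_axioms g])
      (simp_all add: Di alg_mult_closed)
  then show ?thesis
    using Di(3) by (simp add: Di(1) merged_def T.add_pow_minus_distrib g_closed
        absorb_permute_tuples D bilinear_mult bilinear_flip)
qed

lemma merged_transpose:
  assumes "D \<in> Perms" "0 < i" "i < N"
  shows "merged mult_op (D \<circ> transpose i N, i) = \<ominus>\<^bsub>M\<^esub> merged flip_op (D, i)"
proof -
  have p: "transpose i N permutes {..<length xs}"
    by (rule permutes_swap_id) (use assms length_xs in auto)
  have "absorb_last mult_op i (permute_list (D \<circ> transpose i N) xs) =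
      absorb_last flip_op i (permute_list D xs)"
    using assms length_xs by (simp add: permute_list_compose[OF p] absorb_last_transpose)
  moreover have "sign (D \<circ> transpose i N) = - sign D"
    using assms by (simp add: sign_compose PermsD(3) permutation_swap_id sign_swap_id)
  ultimately show ?thesis
    using assms by (simp add: merged_def T.add_pow_minus_int g_closed absorb_permute_tuples
        PermsD(1) bilinear_mult bilinear_flip)
qed

text \<open>
  Expand each commutator. The summands \<open>a b\<close> with \<open>D i < D N\<close> are the merged terms over the
  increasing pairs. Precomposing \<open>D\<close> with the transposition of \<open>i\<close> and \<open>N\<close> turns the summands
  \<open>b a\<close> with \<open>i > 0\<close> into the merged terms with \<open>D i > D N\<close>. Since \<open>D 0 = 0\<close>, the summands with
  \<open>i = 0\<close> have no such partner.
\<close>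

lemma sum_commutators:
  "(\<Oplus>\<^bsub>M\<^esub>z\<in>Increasing. merged (commutator A) z) =
    (\<Oplus>\<^bsub>M\<^esub>z\<in>Perms \<times> {..<N}. merged mult_op z) \<ominus>\<^bsub>M\<^esub> (\<Oplus>\<^bsub>M\<^esub>D\<in>Perms. merged flip_op (D, 0))"
proof -
  let ?All = "Perms \<times> {..<N}"
  let ?Dec = "?All - Increasing"
  let ?Pos = "{(D, i) \<in> Increasing. 0 < i}"
  let ?Zero = "(\<lambda>D. (D, 0 :: nat)) ` Perms"
  have fin: "finite ?All" using finite_Perms by simp
  have sub: "Increasing \<subseteq> ?All" by (auto simp: Increasing_def)
  have finI: "finite Increasing" "finite ?Pos" "finite ?Dec" "finite ?Zero"
    using finite_subset[OF sub fin] fin finite_Perms by (auto intro: rev_finite_subset)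
  have N0: "0 < N" using N by simp
  have D0: "D 0 < D N" if "D \<in> Perms" for D
    using PermsD(2)[OF that] PermsD(4)[OF that, of N 0] N by simp
  have split: "Increasing = ?Pos \<union> ?Zero" "?Pos \<inter> ?Zero = {}"
    using D0 N0 by (auto simp: Increasing_def image_iff)
  let ?mI = "\<Oplus>\<^bsub>M\<^esub>z\<in>Increasing. merged mult_op z"
  let ?fP = "\<Oplus>\<^bsub>M\<^esub>z\<in>?Pos. merged flip_op z"
  let ?f0 = "\<Oplus>\<^bsub>M\<^esub>D\<in>Perms. merged flip_op (D, 0)"
  have clo: "?mI \<in> carrier M" "?fP \<in> carrier M" "?f0 \<in> carrier M"
    using closed_mult closed_flip sub N0 by (auto intro!: T.M.finsum_closed)
  have comm: "(\<Oplus>\<^bsub>M\<^esub>z\<in>Increasing. merged (commutator A) z) =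
      ?mI \<oplus>\<^bsub>M\<^esub> \<ominus>\<^bsub>M\<^esub> (\<Oplus>\<^bsub>M\<^esub>z\<in>Increasing. merged flip_op z)"
  proof -
    have "(\<Oplus>\<^bsub>M\<^esub>z\<in>Increasing. merged (commutator A) z) =
        (\<Oplus>\<^bsub>M\<^esub>z\<in>Increasing. merged mult_op z \<oplus>\<^bsub>M\<^esub> \<ominus>\<^bsub>M\<^esub> merged flip_op z)"
      by (rule T.M.finsum_cong')
        (use sub closed_mult closed_flip merged_commutator in \<open>auto simp: a_minus_def subset_iff\<close>)
    also have "\<dots> = ?mI \<oplus>\<^bsub>M\<^esub> (\<Oplus>\<^bsub>M\<^esub>z\<in>Increasing. \<ominus>\<^bsub>M\<^esub> merged flip_op z)"
      by (rule T.M.finsum_addf) (use sub closed_mult closed_flip in auto)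
    finally show ?thesis
      using finI sub closed_flip by (subst (asm) T.finsum_uminus) auto
  qed
  have flip: "(\<Oplus>\<^bsub>M\<^esub>z\<in>Increasing. merged flip_op z) = ?fP \<oplus>\<^bsub>M\<^esub> ?f0"
  proof -
    have "(\<Oplus>\<^bsub>M\<^esub>z\<in>Increasing. merged flip_op z) = ?fP \<oplus>\<^bsub>M\<^esub> (\<Oplus>\<^bsub>M\<^esub>z\<in>?Zero. merged flip_op z)"
      by (subst split(1), rule T.M.finsum_Un_disjoint)
        (use finI split sub closed_flip N0 in \<open>auto simp: subset_iff\<close>)
    also have "(\<Oplus>\<^bsub>M\<^esub>z\<in>?Zero. merged flip_op z) = ?f0"
      by (rule T.M.finsum_reindex_bij_betw[symmetric])
        (use closed_flip N0 in \<open>auto simp: bij_betw_def inj_on_def\<close>)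
    finally show ?thesis .
  qed
  have dec: "(\<Oplus>\<^bsub>M\<^esub>z\<in>?Dec. merged mult_op z) = \<ominus>\<^bsub>M\<^esub> ?fP"
  proof -
    let ?h = "\<lambda>(D :: nat \<Rightarrow> nat, i). (D \<circ> transpose i N, i)"
    have swap: "D \<circ> transpose i N \<in> Perms" if "D \<in> Perms" "0 < i" "i < N" for D i
      using that permutes_compose[of "transpose i N" "{1..N}" D] permutes_swap_id[of i "{1..N}" N]
      by (simp add: Perms_def)
    have pos: "0 < i" if "D \<in> Perms" "\<not> D i < D N" for D i
      using that D0 by (cases i) auto
    \<comment> \<open>transposing \<open>i\<close> and \<open>N\<close> is an involution exchanging \<open>D i < D N\<close> with \<open>D i > D N\<close>\<close>
    have "bij_betw ?h ?Pos ?Dec"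
    proof (rule bij_betw_byWitness[where f' = ?h])
      show "?h ` ?Pos \<subseteq> ?Dec" by (auto simp: Increasing_def swap)
      show "?h ` ?Dec \<subseteq> ?Pos"
      proof clarify
        fix D i assume *: "D \<in> Perms" "i < N" "(D, i) \<notin> Increasing"
        then have "\<not> D i < D N" by (simp add: Increasing_def)
        moreover have "D i \<noteq> D N" using PermsD(4)[OF *(1), of i N] *(2) by simp
        ultimately show "(D \<circ> transpose i N, i) \<in> Increasing \<and> 0 < i"
          using * pos by (auto simp: Increasing_def swap)
      qed
    qed (auto simp: comp_assoc)
    then have "(\<Oplus>\<^bsub>M\<^esub>z\<in>?Dec. merged mult_op z) = (\<Oplus>\<^bsub>M\<^esub>z\<in>?Pos. merged mult_op (?h z))"
      by (rule T.M.finsum_reindex_bij_betw[symmetric]) (use closed_mult in auto)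
    also have "\<dots> = (\<Oplus>\<^bsub>M\<^esub>z\<in>?Pos. \<ominus>\<^bsub>M\<^esub> merged flip_op z)"
      by (rule T.M.finsum_cong')
        (use closed_flip sub merged_transpose in \<open>auto simp: Increasing_def\<close>)
    also have "\<dots> = \<ominus>\<^bsub>M\<^esub> ?fP"
      by (rule T.finsum_uminus) (use finI sub closed_flip in auto)
    finally show ?thesis .
  qed
  have "(\<Oplus>\<^bsub>M\<^esub>z\<in>?All. merged mult_op z) = ?mI \<oplus>\<^bsub>M\<^esub> (\<Oplus>\<^bsub>M\<^esub>z\<in>?Dec. merged mult_op z)"
  proof -
    have "?All = Increasing \<union> ?Dec" using sub by auto
    then show ?thesis
      using T.M.finsum_Un_disjoint[of Increasing ?Dec "merged mult_op"] finI sub closed_mult by auto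
  qed
  then show ?thesis
    using clo by (simp add: comm flip dec a_minus_def T.M.minus_add T.M.a_assoc)
qed

text \<open>
  The face \<open>d\<^sub>i\<close> multiplies the entries at positions \<open>i\<close> and \<open>i + 1\<close>. Moving the second of these to
  the end costs \<open>(-1)\<^bsup>N-i-1\<^esup>\<close>, and \<open>N - i - 1 = n - i\<close>.
\<close>

lemma first_faces_term:
  assumes s: "s \<in> Perms" and i: "i < N"
  shows "[(sign s)] \<cdot>\<^bsub>M\<^esub> ([((-1 :: int) ^ i)] \<cdot>\<^bsub>M\<^esub> g (hochschild_face A N i (permute_list s xs))) =
    merged mult_op (s \<circ> move_to_end N (Suc i), i)"
proof -
  let ?c = "move_to_end N (Suc i)"
  have c: "?c permutes {Suc i..N}" by (rule move_to_end_permutes) (use i in simp)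
  then have c': "?c permutes {..<length xs}" by (rule permutes_subset) (use length_xs in auto)
  have sc: "s \<circ> ?c permutes {..<Suc N}"
    using permutes_compose[OF c'] PermsD(1)[OF s] length_xs by simp
  have face: "hochschild_face A N i (permute_list s xs) = absorb_last mult_op i (permute_list (s \<circ> ?c) xs)"
    using i length_xs by (simp add: hochschild_face_eq permute_list_compose[OF c'])
  obtain d where d: "n = i + d" using i N by (auto simp: less_Suc_eq_le dest: le_Suc_ex)
  have "(-1) ^ n * sign (s \<circ> ?c) = sign s * (-1 :: int) ^ i"
    using i N permutes_imp_permutation[OF _ c] PermsD(3)[OF s]
    by (simp add: sign_compose sign_move_to_end d power_add)
  then show ?thesis
    using i sc by (simp add: merged_def face T.add_pow_add_pow g_closed absorb_permute_tuples bilinear_mult)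
qed

lemma last_face_term:
  assumes s: "s \<in> Perms"
  shows "[(sign s)] \<cdot>\<^bsub>M\<^esub> ([((-1 :: int) ^ N)] \<cdot>\<^bsub>M\<^esub> g (hochschild_face A N N (permute_list s xs))) =
    \<ominus>\<^bsub>M\<^esub> merged flip_op (s, 0)"
proof -
  have N0: "0 < N" using N by simp
  have face: "hochschild_face A N N (permute_list s xs) = absorb_last flip_op 0 (permute_list s xs)"
    using N0 length_xs by (simp add: hochschild_last_face_eq)
  have "sign s * (-1 :: int) ^ N = - ((-1) ^ n * sign s)" by (simp add: N)
  then show ?thesis
    using N0 PermsD(1)[OF s] by (simp add: merged_def face T.add_pow_add_pow g_closed
        absorb_permute_tuples bilinear_mult bilinear_flip T.add_pow_minus_int)
qed

text \<open>
  For each fixed \<open>i\<close>, composition with the cycle moving \<open>i + 1\<close> to the end permutes the summation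
  range, because the cycle fixes \<open>0\<close>.
\<close>

lemma sum_hochschild:
  "(\<Oplus>\<^bsub>M\<^esub>s\<in>Perms. [(sign s)] \<cdot>\<^bsub>M\<^esub>
      (\<Oplus>\<^bsub>M\<^esub>i\<in>{0..N}. [((-1 :: int) ^ i)] \<cdot>\<^bsub>M\<^esub> g (hochschild_face A N i (permute_list s xs)))) =
    (\<Oplus>\<^bsub>M\<^esub>z\<in>Perms \<times> {..<N}. merged mult_op z) \<ominus>\<^bsub>M\<^esub> (\<Oplus>\<^bsub>M\<^esub>D\<in>Perms. merged flip_op (D, 0))"
proof -
  have N0: "0 < N" using N by simp
  let ?h = "\<lambda>(s :: nat \<Rightarrow> nat, i). (s \<circ> move_to_end N (Suc i), i)"
  have cycle: "move_to_end N (Suc i) permutes {1..N}" if "i < N" for i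
    by (rule permutes_subset[OF move_to_end_permutes]) (use that in auto)
  have h_closed: "s \<circ> move_to_end N (Suc i) \<in> Perms" if "s \<in> Perms" "i < N" for s i
    using that permutes_compose[OF cycle[OF that(2)]] by (simp add: Perms_def)
  have face_closed: "g (hochschild_face A N i (permute_list s xs)) \<in> carrier M"
    if s: "s \<in> Perms" and i: "i \<le> N" for s i
  proof (cases "i = N")
    case True
    then show ?thesis
      using N0 length_xs PermsD(1)[OF s]
      by (simp add: hochschild_last_face_eq g_closed absorb_permute_tuples bilinear_flip bilinear_mult)
  next
    case False
    then have i: "i < N" using i by simp
    have c': "move_to_end N (Suc i) permutes {..<length xs}"
      by (rule permutes_subset[OF cycle[OF i]]) (use length_xs in auto)
    have "hochschild_face A N i (permute_list s xs) =
        absorb_last mult_op i (permute_list (s \<circ> move_to_end N (Suc i)) xs)"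
      using i length_xs by (simp add: hochschild_face_eq permute_list_compose[OF c'])
    then show ?thesis
      using i PermsD(1)[OF h_closed[OF s i]] by (simp add: g_closed absorb_permute_tuples bilinear_mult)
  qed
  have inner: "[(sign s)] \<cdot>\<^bsub>M\<^esub>
      (\<Oplus>\<^bsub>M\<^esub>i\<in>{0..N}. [((-1 :: int) ^ i)] \<cdot>\<^bsub>M\<^esub> g (hochschild_face A N i (permute_list s xs))) =
      (\<Oplus>\<^bsub>M\<^esub>i\<in>{..<N}. merged mult_op (?h (s, i))) \<oplus>\<^bsub>M\<^esub> \<ominus>\<^bsub>M\<^esub> merged flip_op (s, 0)"
    if s: "s \<in> Perms" for s
  proof -
    let ?t = "\<lambda>i. [(sign s)] \<cdot>\<^bsub>M\<^esub> ([((-1 :: int) ^ i)] \<cdot>\<^bsub>M\<^esub> g (hochschild_face A N i (permute_list s xs)))"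
    have "[(sign s)] \<cdot>\<^bsub>M\<^esub>
        (\<Oplus>\<^bsub>M\<^esub>i\<in>{0..N}. [((-1 :: int) ^ i)] \<cdot>\<^bsub>M\<^esub> g (hochschild_face A N i (permute_list s xs))) =
        (\<Oplus>\<^bsub>M\<^esub>i\<in>{0..N}. ?t i)"
      by (rule T.finsum_add_pow) (use face_closed[OF s] in auto)
    also have "\<dots> = (\<Oplus>\<^bsub>M\<^esub>i\<in>insert N {..<N}. ?t i)"
      by (rule arg_cong[where f = "finsum M ?t"]) auto
    also have "\<dots> = ?t N \<oplus>\<^bsub>M\<^esub> (\<Oplus>\<^bsub>M\<^esub>i\<in>{..<N}. ?t i)"
      by (rule T.M.finsum_insert) (use face_closed[OF s] in auto)
    also have "(\<Oplus>\<^bsub>M\<^esub>i\<in>{..<N}. ?t i) = (\<Oplus>\<^bsub>M\<^esub>i\<in>{..<N}. merged mult_op (?h (s, i)))"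
      by (rule T.M.finsum_cong') (use s h_closed closed_mult first_faces_term in auto)
    also have "?t N = \<ominus>\<^bsub>M\<^esub> merged flip_op (s, 0)"
      by (rule last_face_term[OF s])
    also have "\<ominus>\<^bsub>M\<^esub> merged flip_op (s, 0) \<oplus>\<^bsub>M\<^esub> (\<Oplus>\<^bsub>M\<^esub>i\<in>{..<N}. merged mult_op (?h (s, i))) =
        (\<Oplus>\<^bsub>M\<^esub>i\<in>{..<N}. merged mult_op (?h (s, i))) \<oplus>\<^bsub>M\<^esub> \<ominus>\<^bsub>M\<^esub> merged flip_op (s, 0)"
      by (rule T.M.a_comm)
        (use s N0 h_closed closed_mult closed_flip in \<open>auto intro!: T.M.finsum_closed T.M.a_inv_closed\<close>)
    finally show ?thesis .
  qed
  have bij: "bij_betw ?h (Perms \<times> {..<N}) (Perms \<times> {..<N})"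
  proof (rule bij_betw_byWitness[where f' = "\<lambda>(s, i). (s \<circ> Hilbert_Choice.inv (move_to_end N (Suc i)), i)"])
    show "?h ` (Perms \<times> {..<N}) \<subseteq> Perms \<times> {..<N}" using h_closed by auto
    show "(\<lambda>(s, i). (s \<circ> Hilbert_Choice.inv (move_to_end N (Suc i)), i)) ` (Perms \<times> {..<N}) \<subseteq> Perms \<times> {..<N}"
      using permutes_compose[OF permutes_inv[OF cycle]] by (auto simp: Perms_def)
  qed (auto simp: comp_assoc permutes_inv_o[OF cycle])
  have "(\<Oplus>\<^bsub>M\<^esub>s\<in>Perms. [(sign s)] \<cdot>\<^bsub>M\<^esub>
      (\<Oplus>\<^bsub>M\<^esub>i\<in>{0..N}. [((-1 :: int) ^ i)] \<cdot>\<^bsub>M\<^esub> g (hochschild_face A N i (permute_list s xs)))) =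
      (\<Oplus>\<^bsub>M\<^esub>s\<in>Perms. (\<Oplus>\<^bsub>M\<^esub>i\<in>{..<N}. merged mult_op (?h (s, i))) \<oplus>\<^bsub>M\<^esub> \<ominus>\<^bsub>M\<^esub> merged flip_op (s, 0))"
    by (rule T.M.finsum_cong')
      (use inner h_closed closed_mult closed_flip N0 in \<open>auto intro!: T.M.finsum_closed T.M.a_closed T.M.a_inv_closed\<close>)
  also have "\<dots> = (\<Oplus>\<^bsub>M\<^esub>s\<in>Perms. \<Oplus>\<^bsub>M\<^esub>i\<in>{..<N}. merged mult_op (?h (s, i))) \<oplus>\<^bsub>M\<^esub>
      (\<Oplus>\<^bsub>M\<^esub>s\<in>Perms. \<ominus>\<^bsub>M\<^esub> merged flip_op (s, 0))"
    by (rule T.M.finsum_addf)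
      (use h_closed closed_mult closed_flip N0 in \<open>auto intro!: T.M.finsum_closed\<close>)
  also have "(\<Oplus>\<^bsub>M\<^esub>s\<in>Perms. \<Oplus>\<^bsub>M\<^esub>i\<in>{..<N}. merged mult_op (?h (s, i))) =
      (\<Oplus>\<^bsub>M\<^esub>z\<in>Perms \<times> {..<N}. merged mult_op (?h z))"
    by (rule T.M.finsum_Times) (use h_closed closed_mult finite_Perms in auto)
  also have "\<dots> = (\<Oplus>\<^bsub>M\<^esub>z\<in>Perms \<times> {..<N}. merged mult_op z)"
    by (rule T.M.finsum_reindex_bij_betw[OF bij]) (use closed_mult in auto)
  also have "(\<Oplus>\<^bsub>M\<^esub>s\<in>Perms. \<ominus>\<^bsub>M\<^esub> merged flip_op (s, 0)) = \<ominus>\<^bsub>M\<^esub> (\<Oplus>\<^bsub>M\<^esub>s\<in>Perms. merged flip_op (s, 0))"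
    by (rule T.finsum_uminus) (use closed_flip finite_Perms N0 in auto)
  finally show ?thesis by (simp add: a_minus_def)
qed

text \<open>
  Removing the \<open>q\<close>-th entry means moving it to the end before it is absorbed, at the cost of
  \<open>(-1)\<^bsup>N-q\<^esup>\<close>. A permutation \<open>t\<close> of the remaining entries carries the bracket from position \<open>p\<close> to
  the position that \<open>t\<close> maps to \<open>p\<close>.
\<close>

lemma merged_leibniz_term:
  assumes p: "p < q" "q \<le> N" and t: "t permutes {1..n}"
  shows "[((-1 :: int) ^ (q + 1))] \<cdot>\<^bsub>M\<^esub> ([(sign t)] \<cdot>\<^bsub>M\<^esub>
      g (permute_list t (absorb_last (commutator A) p (permute_list (move_to_end N q) xs)))) =
    merged (commutator A) (move_to_end N q \<circ> t, Hilbert_Choice.inv t p)"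
proof -
  let ?c = "move_to_end N q"
  have c: "?c permutes {q..N}" by (rule move_to_end_permutes) (use p in simp)
  have t': "t permutes {..<N}" "t permutes {..<length xs}"
    by (rule permutes_subset[OF t]; use N length_xs in auto)+
  have c': "?c permutes {..<Suc N}"
    by (rule permutes_subset[OF c]) auto
  have ct: "?c \<circ> t permutes {..<Suc N}"
    using permutes_compose[OF t'(2)] c' length_xs by simp
  have i: "Hilbert_Choice.inv t p < N"
    using permutes_in_image[OF permutes_inv[OF t'(1)], of p] p by simp
  have eq: "permute_list t (absorb_last (commutator A) p (permute_list ?c xs)) =
      absorb_last (commutator A) (Hilbert_Choice.inv t p) (permute_list (?c \<circ> t) xs)"
    using p length_xs by (simp add: permute_list_absorb_last[OF t'(1)] permute_list_compose[OF t'(2)])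
  obtain d where d: "N = q + d" using p by (auto dest: le_Suc_ex)
  have "(-1) ^ N * ((-1) ^ d * sign t) = (-1) ^ q * sign t"
    by (simp add: d power_add)
  then have "(-1) ^ n * sign (?c \<circ> t) = (-1 :: int) ^ (q + 1) * sign t"
    using p permutes_imp_permutation[OF _ c] permutes_imp_permutation[OF _ t]
    by (simp add: sign_compose sign_move_to_end N) (simp add: d[unfolded N])
  then show ?thesis
    using i ct by (simp add: merged_def eq T.add_pow_add_pow g_closed absorb_permute_tuples bilinear_commutator)
qed

text \<open>
  The data \<open>p\<close>, \<open>q\<close>, \<open>t\<close> can be read off from \<open>(D, i)\<close>: the cycle for \<open>q\<close> sends \<open>N\<close> to \<open>q\<close> and fixes
  everything below \<open>q\<close>, so \<open>D N = q\<close> and \<open>D i = p\<close>, and undoing the cycle leaves \<open>t\<close>.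
\<close>

lemma bij_betw_Increasing:
  "bij_betw (\<lambda>((p, q), t). (move_to_end N q \<circ> t, Hilbert_Choice.inv t p))
    ({(i, j). i < j \<and> j \<le> N} \<times> {t. t permutes {1..n}}) Increasing"
    (is "bij_betw ?h ?S _")
proof (rule bij_betw_byWitness[where
      f' = "\<lambda>(D, i). ((D i, D N), Hilbert_Choice.inv (move_to_end N (D N)) \<circ> D)"])
  let ?h' = "\<lambda>(D, i). ((D i, D N), Hilbert_Choice.inv (move_to_end N (D N)) \<circ> D)"
  have cycle: "move_to_end N q permutes {1..N}" if "0 < q" "q \<le> N" for q
    by (rule permutes_subset[OF move_to_end_permutes[OF that(2)]]) (use that in auto)
  have below: "move_to_end N q p = p" if "p < q" "q \<le> N" for p q
    using that by (simp add: move_to_end_def)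
  have last: "move_to_end N q N = q" for q
    by (simp add: move_to_end_def)
  have fwd: "(move_to_end N q \<circ> t) (Hilbert_Choice.inv t p) = p"
      "(move_to_end N q \<circ> t) N = q" "?h ((p, q), t) \<in> Increasing"
    if "p < q" "q \<le> N" "t permutes {1..n}" for p q t
  proof -
    have tN: "t N = N" using permutes_not_in[OF that(3), of N] N by simp
    have t: "t permutes {1..N}" by (rule permutes_subset[OF that(3)]) (use N in auto)
    have t': "t permutes {..<N}" by (rule permutes_subset[OF that(3)]) (use N in auto)
    show 1: "(move_to_end N q \<circ> t) (Hilbert_Choice.inv t p) = p"
      using that by (simp add: permutes_inverses[OF t] below)
    show 2: "(move_to_end N q \<circ> t) N = q" by (simp add: tN last)
    have "move_to_end N q \<circ> t \<in> Perms"
      using permutes_compose[OF t cycle] that by (simp add: Perms_def)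
    moreover have "Hilbert_Choice.inv t p < N"
      using permutes_in_image[OF permutes_inv[OF t'], of p] that by simp
    ultimately show "?h ((p, q), t) \<in> Increasing"
      using 1 2 that by (simp add: Increasing_def)
  qed
  then show "?h ` ?S \<subseteq> Increasing" by blast
  have left: "?h' (?h ((p, q), t)) = ((p, q), t)" if pq: "p < q" "q \<le> N" and t: "t permutes {1..n}" for p q t
  proof -
    have "Hilbert_Choice.inv (move_to_end N q) \<circ> (move_to_end N q \<circ> t) = t"
      using permutes_inv_o(2)[OF cycle, of q] pq by (simp add: comp_assoc[symmetric])
    then show ?thesis
      using fwd(1,2)[OF pq t] by simp
  qed
  then show "\<forall>z\<in>?S. ?h' (?h z) = z" by blast
  have bwd: "?h (?h' (D, i)) = (D, i) \<and> ?h' (D, i) \<in> ?S" if "(D, i) \<in> Increasing" for D i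
  proof -
    have D: "D \<in> Perms" "i < N" "D i < D N" using that by (auto simp: Increasing_def)
    let ?q = "D N"
    have q: "0 < ?q" "?q \<le> N" using D PermsD(5)[OF D(1), of N] by auto
    note c = cycle[OF q]
    let ?t = "Hilbert_Choice.inv (move_to_end N ?q) \<circ> D"
    have t: "?t permutes {1..N}"
      using permutes_compose[OF _ permutes_inv[OF c]] D(1) by (simp add: Perms_def)
    have inv_fix: "Hilbert_Choice.inv (move_to_end N ?q) l = m" if "move_to_end N ?q m = l" for l m
      using permutes_inv_eq[OF c] that by blast
    have tN: "?t N = N" by (simp add: inv_fix last)
    have tn: "?t permutes {1..n}"
    proof (rule permutes_superset[OF t])
      fix x assume "x \<in> {1..N} - {1..n}"
      then have "x = N" using N by auto
      then show "?t x = x" using tN by simp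
    qed
    have ti: "?t i = D i" by (simp add: inv_fix below D q)
    have "Hilbert_Choice.inv ?t (D i) = i"
      using permutes_inv_eq[OF t] ti by blast
    moreover have "move_to_end N ?q \<circ> ?t = D"
      by (simp add: comp_assoc[symmetric] permutes_inv_o(1)[OF c])
    ultimately show ?thesis using tn D(3) q by simp
  qed
  show "\<forall>z\<in>Increasing. ?h (?h' z) = z"
  proof
    fix z assume z: "z \<in> Increasing"
    obtain D i where "z = (D, i)" by (cases z)
    then show "?h (?h' z) = z" using bwd[of D i] z by (simp only:)
  qed
  show "?h' ` Increasing \<subseteq> ?S"
  proof
    fix w assume "w \<in> ?h' ` Increasing"
    then obtain D i where "(D, i) \<in> Increasing" "w = ?h' (D, i)" by fast
    then show "w \<in> ?S" using bwd[of D i] by (simp only:)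
  qed
qed

lemma sum_leibniz:
  "(\<Oplus>\<^bsub>M\<^esub>z\<in>{(i, j). i < j \<and> j \<le> N}. [((-1 :: int) ^ (snd z + 1))] \<cdot>\<^bsub>M\<^esub>
      (\<Oplus>\<^bsub>M\<^esub>t\<in>{t. t permutes {1..n}}. [(sign t)] \<cdot>\<^bsub>M\<^esub>
        g (permute_list t (absorb_last (commutator A) (fst z) (permute_list (move_to_end N (snd z)) xs))))) =
    (\<Oplus>\<^bsub>M\<^esub>z\<in>Increasing. merged (commutator A) z)"
    (is "(\<Oplus>\<^bsub>M\<^esub>z\<in>?I. ?l z) = _")
proof -
  let ?P = "{t. t permutes {1..n}}"
  let ?h = "\<lambda>((p, q), t). (move_to_end N q \<circ> t, Hilbert_Choice.inv t p)"
  have fin: "finite ?I" "finite ?P"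
  proof -
    show "finite ?I" by (rule finite_subset[of _ "{..N} \<times> {..N}"]) auto
    show "finite ?P" by (simp add: finite_permutations)
  qed
  have clo: "merged (commutator A) (?h (z, t)) \<in> carrier M" if "z \<in> ?I" "t \<in> ?P" for z t
  proof -
    have "?h (z, t) \<in> Increasing" using bij_betw_apply[OF bij_betw_Increasing] that by blast
    then show ?thesis by (intro closed_comm) (auto simp: Increasing_def)
  qed
  have term_closed:
    "g (permute_list t (absorb_last (commutator A) p (permute_list (move_to_end N q) xs))) \<in> carrier M"
    if "p < q" "q \<le> N" "t permutes {1..n}" for p q t
  proof (rule g_closed, rule entrywise_linear_tuples[OF entrywise_linear_permute_list])
    show "module R A" by (rule module_axioms)
    show "t permutes {..<N}" by (rule permutes_subset[OF that(3)]) (use N in auto)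
    show "absorb_last (commutator A) p (permute_list (move_to_end N q) xs) \<in> tuples A N"
    proof (rule absorb_permute_tuples[OF bilinear_commutator])
      show "move_to_end N q permutes {..<Suc N}"
        by (rule permutes_subset[OF move_to_end_permutes[OF that(2)]]) auto
    qed (use that in simp)
  qed
  have "(\<Oplus>\<^bsub>M\<^esub>z\<in>?I. ?l z) = (\<Oplus>\<^bsub>M\<^esub>z\<in>?I. \<Oplus>\<^bsub>M\<^esub>t\<in>?P. merged (commutator A) (?h (z, t)))"
  proof (rule T.M.finsum_cong')
    fix z assume "z \<in> ?I"
    then obtain p q where z: "z = (p, q)" "p < q" "q \<le> N" by auto
    have "?l z = (\<Oplus>\<^bsub>M\<^esub>t\<in>?P. [((-1 :: int) ^ (q + 1))] \<cdot>\<^bsub>M\<^esub> ([(sign t)] \<cdot>\<^bsub>M\<^esub>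
        g (permute_list t (absorb_last (commutator A) p (permute_list (move_to_end N q) xs)))))"
      using T.finsum_add_pow[OF fin(2)] term_closed[OF z(2,3)] by (simp add: z(1) Pi_iff)
    also have "\<dots> = (\<Oplus>\<^bsub>M\<^esub>t\<in>?P. merged (commutator A) (?h (z, t)))"
      by (rule T.M.finsum_cong') (use clo z merged_leibniz_term in auto)
    finally show "?l z = (\<Oplus>\<^bsub>M\<^esub>t\<in>?P. merged (commutator A) (?h (z, t)))" .
  qed (use clo in \<open>auto intro!: T.M.finsum_closed\<close>)
  also have "\<dots> = (\<Oplus>\<^bsub>M\<^esub>z\<in>?I \<times> ?P. merged (commutator A) (?h z))"
    by (rule T.M.finsum_Times) (use fin clo in auto)
  also have "\<dots> = (\<Oplus>\<^bsub>M\<^esub>z\<in>Increasing. merged (commutator A) z)"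
    by (rule T.M.finsum_reindex_bij_betw[OF bij_betw_Increasing])
      (use closed_comm in \<open>auto simp: Increasing_def\<close>)
  finally show ?thesis .
qed

end

section \<open>Maps induced on homology\<close>

lemma (in module) module_restrict_carrier:
  "submodule H R M \<Longrightarrow> module R (M\<lparr>carrier := H\<rparr>)"
  using submodule.submodule_is_module module_axioms by blast

lemma homology_eq:
  "homology C d n =
    (quotient_module (C n) (boundaries C d n))\<lparr>carrier := homology_class C d n ` cycles C d n\<rparr>"
  by (auto simp: homology_def quotient_module_def homology_class_def A_RCOSETS_def' set_add_def
      set_mult_def a_r_coset_def' fun_eq_iff)

lemma submodule_image:
  assumes h: "linear_map R M N h" and Z: "submodule Z R M"
  shows "submodule (h ` Z) R N"
proof -
  interpret M: module R M using h by (simp add: linear_map_def)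
  interpret N: module R N using h by (simp add: linear_map_def)
  note E = M.submoduleE[OF Z]
  have z: "\<zero>\<^bsub>M\<^esub> \<in> Z" using subgroup.one_closed[OF submodule.axioms(1)[OF Z]] by simp
  have neg: "\<ominus>\<^bsub>N\<^esub> h x = h (\<ominus>\<^bsub>M\<^esub> x)" if "x \<in> Z" for x
  proof -
    have x: "x \<in> carrier M" using that E(1) by blast
    then have "h (\<zero>\<^bsub>M\<^esub> \<ominus>\<^bsub>M\<^esub> x) = \<zero>\<^bsub>N\<^esub> \<ominus>\<^bsub>N\<^esub> h x"
      using linear_map_facts(2,3)[OF h] by simp
    then show ?thesis using x linear_map_closed[OF h x] by (simp add: a_minus_def)
  qed
  show ?thesis
  proof (rule N.submoduleI)
    show "h ` Z \<subseteq> carrier N" using E(1) linear_map_closed[OF h] by blast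
    show "\<zero>\<^bsub>N\<^esub> \<in> h ` Z" using linear_map_facts(2)[OF h] z by (metis image_eqI)
    show "\<ominus>\<^bsub>N\<^esub> a \<in> h ` Z" if "a \<in> h ` Z" for a using that neg E(3) by blast
    show "a \<oplus>\<^bsub>N\<^esub> b \<in> h ` Z" if "a \<in> h ` Z" "b \<in> h ` Z" for a b
    proof -
      obtain x y where xy: "x \<in> Z" "y \<in> Z" "a = h x" "b = h y" using \<open>a \<in> h ` Z\<close> \<open>b \<in> h ` Z\<close> by blast
      then have "a \<oplus>\<^bsub>N\<^esub> b = h (x \<oplus>\<^bsub>M\<^esub> y)" using linear_map_add[OF h] E(1) by (simp add: subset_iff)
      then show ?thesis using E(5) xy by blast
    qed
    show "r \<odot>\<^bsub>N\<^esub> a \<in> h ` Z" if "r \<in> carrier R" "a \<in> h ` Z" for r a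
    proof -
      obtain x where x: "x \<in> Z" "a = h x" using \<open>a \<in> h ` Z\<close> by blast
      then have "r \<odot>\<^bsub>N\<^esub> a = h (r \<odot>\<^bsub>M\<^esub> x)" using linear_map_smult[OF h that(1)] E(1) by (simp add: subset_iff)
      then show ?thesis using E(4) x that(1) by blast
    qed
  qed
qed

text \<open>
  As the differentials are linear, cycles and boundaries are submodules, and homology is the image of
  the cycles in the quotient by the boundaries.
\<close>

locale differentials =
  fixes R :: "('k, 'r) ring_scheme" and C :: "nat \<Rightarrow> ('k, 'a, 'm) module_scheme"
    and d :: "nat \<Rightarrow> 'a \<Rightarrow> 'a"
  assumes diff_linear: "\<And>n. linear_map R (C (Suc n)) (C n) (d n)"
begin

lemma module_chain: "module R (C n)"
  using diff_linear[of n] by (simp add: linear_map_def)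

lemma submodule_cycles: "submodule (cycles C d n) R (C n)"
proof (cases n)
  case 0
  then show ?thesis
    using module.carrier_is_submodule[OF module_chain, of 0] by (simp add: cycles_def)
next
  case (Suc m)
  then show ?thesis
    using linear_map_facts(1)[OF diff_linear, of m] by (simp add: cycles_def)
qed

lemma submodule_boundaries: "submodule (boundaries C d n) R (C n)"
  unfolding boundaries_def
  by (rule submodule_image[OF diff_linear module.carrier_is_submodule[OF module_chain]])

lemma cycles_carrier: "z \<in> cycles C d n \<Longrightarrow> z \<in> carrier (C n)"
  using module.submoduleE(1)[OF module_chain submodule_cycles] by blast

lemmas quotient_facts =
  quotient_module_facts[OF module_chain submodule_boundaries, folded homology_class_def]

lemma class_linear:
  "linear_map R (C n) (quotient_module (C n) (boundaries C d n)) (homology_class C d n)"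
  using module_chain quotient_facts(1,3,4) module_quotient_module[OF module_chain submodule_boundaries]
  by (simp add: linear_map_def)

lemma module_homology: "module R (homology C d n)"
  unfolding homology_eq
  by (intro module.module_restrict_carrier submodule_image[OF class_linear submodule_cycles]
      module_quotient_module[OF module_chain submodule_boundaries])

lemma carrier_homology: "carrier (homology C d n) = homology_class C d n ` cycles C d n"
  by (simp add: homology_eq)

lemma class_add:
  "x \<in> carrier (C n) \<Longrightarrow> y \<in> carrier (C n) \<Longrightarrow>
    homology_class C d n x \<oplus>\<^bsub>homology C d n\<^esub> homology_class C d n y = homology_class C d n (x \<oplus>\<^bsub>C n\<^esub> y)"
  using quotient_facts(3) by (simp add: homology_eq)

lemma class_smult:
  "r \<in> carrier R \<Longrightarrow> x \<in> carrier (C n) \<Longrightarrow>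
    r \<odot>\<^bsub>homology C d n\<^esub> homology_class C d n x = homology_class C d n (r \<odot>\<^bsub>C n\<^esub> x)"
  using quotient_facts(4) by (simp add: homology_eq)

lemma in_homology_class:
  assumes "z \<in> carrier (C n)"
  shows "w \<in> homology_class C d n z \<longleftrightarrow> (\<exists>x\<in>carrier (C (Suc n)). w = d n x \<oplus>\<^bsub>C n\<^esub> z)"
  by (auto simp: homology_class_def a_r_coset_def' boundaries_def)

lemma homology_class_add_boundary:
  assumes "z \<in> carrier (C n)" "x \<in> carrier (C (Suc n))"
  shows "homology_class C d n (d n x \<oplus>\<^bsub>C n\<^esub> z) = homology_class C d n z"
proof -
  interpret module R "C n" by (rule module_chain)
  have dx: "d n x \<in> carrier (C n)" by (rule linear_map_closed[OF diff_linear assms(2)])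
  have "(d n x \<oplus>\<^bsub>C n\<^esub> z) \<ominus>\<^bsub>C n\<^esub> z = d n x"
    using dx assms by (simp add: a_minus_def M.a_assoc M.r_neg)
  then show ?thesis
    using dx assms by (simp add: quotient_facts(6) boundaries_def)
qed

end

text \<open>
  A linear map between two terms of complexes induces a map on homology in these degrees as soon
  as it preserves cycles and boundaries. The degrees \<open>m\<close> and \<open>n\<close> are independent, since the
  antisymmetrization lowers the degree by one.
\<close>

locale homology_morphism = C: differentials R C d + D: differentials R D e
  for R :: "('k, 'r) ring_scheme" and C :: "nat \<Rightarrow> ('k, 'a, 'm) module_scheme" and d
    and D :: "nat \<Rightarrow> ('k, 'b, 'n) module_scheme" and e +
  fixes m n :: nat and \<phi> :: "'a \<Rightarrow> 'b"
  assumes linear: "linear_map R (C m) (D n) \<phi>"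
    and cycles: "\<And>z. z \<in> cycles C d m \<Longrightarrow> \<phi> z \<in> cycles D e n"
    and boundaries: "\<And>x. x \<in> carrier (C (Suc m)) \<Longrightarrow> \<exists>y\<in>carrier (D (Suc n)). \<phi> (d m x) = e n y"
begin

text \<open>
  The union defining the induced map ranges over one repeated class: representatives differ by a
  boundary, whose image is again a boundary.
\<close>

lemma homology_map_class:
  assumes z: "z \<in> carrier (C m)"
  shows "homology_map D e n \<phi> (homology_class C d m z) = homology_class D e n (\<phi> z)"
proof -
  have "homology_class D e n (\<phi> w) = homology_class D e n (\<phi> z)"
    if w: "w \<in> homology_class C d m z" for w
  proof -
    obtain x where x: "x \<in> carrier (C (Suc m))" "w = d m x \<oplus>\<^bsub>C m\<^esub> z"
      using w C.in_homology_class[OF z] by blast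
    obtain y where y: "y \<in> carrier (D (Suc n))" "\<phi> (d m x) = e n y"
      using boundaries[OF x(1)] by blast
    have "\<phi> w = e n y \<oplus>\<^bsub>D n\<^esub> \<phi> z"
      using linear_map_add[OF linear linear_map_closed[OF C.diff_linear x(1)] z] x y by simp
    then show ?thesis
      using D.homology_class_add_boundary[OF linear_map_closed[OF linear z] y(1)] by simp
  qed
  moreover have "homology_class C d m z \<noteq> {}"
  proof -
    have "d m \<zero>\<^bsub>C (Suc m)\<^esub> \<oplus>\<^bsub>C m\<^esub> z \<in> homology_class C d m z"
      using C.in_homology_class[OF z] module.axioms(2)[OF C.module_chain, of "Suc m"]
      by (auto simp: abelian_group_def abelian_monoid.zero_closed)
    then show ?thesis by blast
  qed
  ultimately show ?thesis
    unfolding homology_map_def by auto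
qed

lemma homology_map_linear:
  "linear_map R (homology C d m) (homology D e n) (homology_map D e n \<phi>)"
  unfolding linear_map_def
proof (intro conjI ballI C.module_homology D.module_homology)
  show "homology_map D e n \<phi> \<in> carrier (homology C d m) \<rightarrow> carrier (homology D e n)"
    using cycles by (auto simp: C.carrier_homology D.carrier_homology homology_map_class C.cycles_carrier)
next
  interpret Cm: module R "C m" by (rule C.module_chain)
  fix X Y assume "X \<in> carrier (homology C d m)" "Y \<in> carrier (homology C d m)"
  then show "homology_map D e n \<phi> (X \<oplus>\<^bsub>homology C d m\<^esub> Y) =
      homology_map D e n \<phi> X \<oplus>\<^bsub>homology D e n\<^esub> homology_map D e n \<phi> Y"
    using linear_map_closed[OF linear] linear_map_add[OF linear]
    by (auto simp: C.carrier_homology homology_map_class C.cycles_carrier C.class_add D.class_add)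
next
  interpret Cm: module R "C m" by (rule C.module_chain)
  fix r X assume "r \<in> carrier R" "X \<in> carrier (homology C d m)"
  then show "homology_map D e n \<phi> (r \<odot>\<^bsub>homology C d m\<^esub> X) = r \<odot>\<^bsub>homology D e n\<^esub> homology_map D e n \<phi> X"
    using linear_map_closed[OF linear] linear_map_smult[OF linear]
    by (auto simp: C.carrier_homology homology_map_class C.cycles_carrier C.class_smult D.class_smult)
qed

end

section \<open>The antisymmetrization as a natural chain map\<close>

lemma entrywise_linear_cong:
  assumes "entrywise_linear R A m B n op" "\<And>xs. xs \<in> tuples A m \<Longrightarrow> op' xs = op xs"
  shows "entrywise_linear R A m B n op'"
  using assms unfolding entrywise_linear_def by (simp add: tuples_update)

definition leibniz_term :: "('k, 'a, 'm) module_scheme \<Rightarrow> nat \<times> nat \<Rightarrow> 'a list \<Rightarrow> 'a list"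
  where "leibniz_term A p xs = (case p of (i, j) \<Rightarrow>
    take j (xs[i := commutator A (xs ! i) (xs ! j)]) @ drop (Suc j) xs)"

definition antisym_term :: "nat \<Rightarrow> (nat \<Rightarrow> nat) \<Rightarrow> 'a list \<Rightarrow> 'a list"
  where "antisym_term n \<sigma> xs = xs ! 0 # map (\<lambda>i. xs ! Hilbert_Choice.inv \<sigma> i) [1..<Suc n]"

lemma leibniz_diff_eq:
  "leibniz_diff R A n = tensor_lift R A (Suc n) (tensor_power R A n)
    (\<lambda>xs. \<Oplus>\<^bsub>tensor_power R A n\<^esub>p\<in>{(i, j). i < j \<and> j \<le> n}.
      [((-1 :: int) ^ (snd p + 1))] \<cdot>\<^bsub>tensor_power R A n\<^esub> pure_tensor R A (leibniz_term A p xs))"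
  by (simp add: leibniz_diff_def leibniz_term_def case_prod_beta)

lemma antisymmetrization_eq:
  "antisymmetrization R A n = tensor_lift R A (Suc n) (tensor_power R A (Suc n))
    (\<lambda>xs. \<Oplus>\<^bsub>tensor_power R A (Suc n)\<^esub>\<sigma>\<in>{\<sigma>. \<sigma> permutes {1..n}}.
      [(sign \<sigma>)] \<cdot>\<^bsub>tensor_power R A (Suc n)\<^esub> pure_tensor R A (antisym_term n \<sigma> xs))"
  by (simp add: antisymmetrization_def antisym_term_def del: upt_Suc)

lemma antisym_term_eq:
  assumes "xs \<in> tuples A (Suc n)" "\<sigma> permutes {1..n}"
  shows "antisym_term n \<sigma> xs = permute_list (Hilbert_Choice.inv \<sigma>) xs"
  unfolding antisym_term_def
  by (rule antisymmetrization_term_eq[OF _ permutes_inv[OF assms(2)]])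
    (use assms(1) in \<open>simp add: tuples_def\<close>)

lemma finite_pairs: "finite {(i :: nat, j). i < j \<and> j \<le> n}"
  by (rule finite_subset[of _ "{..n} \<times> {..n}"]) auto

context assoc_algebra
begin

lemma entrywise_linear_leibniz_term:
  assumes "p \<in> {(i, j). i < j \<and> j \<le> n}"
  shows "entrywise_linear R A (Suc n) A n (leibniz_term A p)"
proof -
  obtain i j where p: "p = (i, j)" "i < j" "j \<le> n" using assms by auto
  have "move_to_end n j permutes {..<Suc n}"
    by (rule permutes_subset[OF move_to_end_permutes[OF p(3)]]) auto
  then have "entrywise_linear R A (Suc n) A n
      (\<lambda>xs. absorb_last (commutator A) i (permute_list (move_to_end n j) xs))"
    using entrywise_linear_compose[OF entrywise_linear_permute_list[OF module_axioms]
        entrywise_linear_absorb_last[OF module_axioms bilinear_commutator]] p by simp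
  then show ?thesis
    by (rule entrywise_linear_cong) (use p in \<open>simp add: leibniz_term_def leibniz_term_eq tuples_def\<close>)
qed

lemma entrywise_linear_hochschild_face:
  assumes "i \<le> Suc n"
  shows "entrywise_linear R A (Suc (Suc n)) A (Suc n) (hochschild_face A (Suc n) i)"
proof (cases "i = Suc n")
  case True
  have "entrywise_linear R A (Suc (Suc n)) A (Suc n) (absorb_last (\<lambda>x y. y \<otimes>\<^bsub>A\<^esub> x) 0)"
    by (rule entrywise_linear_absorb_last[OF module_axioms bilinear_flip[OF bilinear_mult]]) simp
  then show ?thesis
    by (rule entrywise_linear_cong) (simp add: True hochschild_last_face_eq tuples_def)
next
  case False
  then have i: "i < Suc n" using assms by simp
  then have "move_to_end (Suc n) (Suc i) permutes {..<Suc (Suc n)}"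
    by (intro permutes_subset[OF move_to_end_permutes]) auto
  then have "entrywise_linear R A (Suc (Suc n)) A (Suc n)
      (\<lambda>xs. absorb_last (\<otimes>\<^bsub>A\<^esub>) i (permute_list (move_to_end (Suc n) (Suc i)) xs))"
    using entrywise_linear_compose[OF entrywise_linear_permute_list[OF module_axioms]
        entrywise_linear_absorb_last[OF module_axioms bilinear_mult]] i by simp
  then show ?thesis
    by (rule entrywise_linear_cong) (use i in \<open>simp add: hochschild_face_eq tuples_def\<close>)
qed

lemma entrywise_linear_antisym_term:
  assumes "\<sigma> permutes {1..n}"
  shows "entrywise_linear R A (Suc n) A (Suc n) (antisym_term n \<sigma>)"
proof -
  note inv = permutes_inv[OF assms]
  have "Hilbert_Choice.inv \<sigma> permutes {..<Suc n}"
    by (rule permutes_subset[OF inv]) auto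
  from entrywise_linear_permute_list[OF module_axioms this] show ?thesis
    by (rule entrywise_linear_cong) (rule antisym_term_eq[OF _ assms])
qed

lemma leibniz_diff_facts:
  shows "linear_map R (tensor_power R A (Suc n)) (tensor_power R A n) (leibniz_diff R A n)"
    and "xs \<in> tuples A (Suc n) \<Longrightarrow> leibniz_diff R A n (pure_tensor R A xs) =
      (\<Oplus>\<^bsub>tensor_power R A n\<^esub>p\<in>{(i, j). i < j \<and> j \<le> n}.
        [((-1 :: int) ^ (snd p + 1))] \<cdot>\<^bsub>tensor_power R A n\<^esub> pure_tensor R A (leibniz_term A p xs))"
  unfolding leibniz_diff_eq
  by (rule tensor_lift_signed_sum[OF module_axioms finite_pairs entrywise_linear_leibniz_term]; assumption)+

lemma hochschild_diff_facts:
  shows "linear_map R (tensor_power R A (Suc (Suc n))) (tensor_power R A (Suc n)) (hochschild_diff R A n)"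
    and "xs \<in> tuples A (Suc (Suc n)) \<Longrightarrow> hochschild_diff R A n (pure_tensor R A xs) =
      (\<Oplus>\<^bsub>tensor_power R A (Suc n)\<^esub>i\<in>{0..Suc n}. [((-1 :: int) ^ i)] \<cdot>\<^bsub>tensor_power R A (Suc n)\<^esub>
        pure_tensor R A (hochschild_face A (Suc n) i xs))"
  unfolding hochschild_diff_def
  by (rule tensor_lift_signed_sum[OF module_axioms _ entrywise_linear_hochschild_face]; simp)+

lemma antisymmetrization_linear:
  "linear_map R (tensor_power R A (Suc n)) (tensor_power R A (Suc n)) (antisymmetrization R A n)"
  unfolding antisymmetrization_eq
  by (rule tensor_lift_signed_sum[OF module_axioms _ entrywise_linear_antisym_term])
    (simp_all add: finite_permutations)

text \<open>
  Inversion is a sign-preserving bijection of the symmetric group, so the inverses in the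
  definition of the antisymmetrization may be dropped.
\<close>

lemma antisymmetrization_pure:
  assumes xs: "xs \<in> tuples A (Suc n)"
  shows "antisymmetrization R A n (pure_tensor R A xs) =
    (\<Oplus>\<^bsub>tensor_power R A (Suc n)\<^esub>s\<in>{s. s permutes {1..n}}.
      [(sign s)] \<cdot>\<^bsub>tensor_power R A (Suc n)\<^esub> pure_tensor R A (permute_list s xs))"
proof -
  let ?P = "{s. s permutes {1..n}}"
  interpret T: module R "tensor_power R A (Suc n)" by (rule module_tensor_power[OF module_axioms])
  have clo: "pure_tensor R A (permute_list s xs) \<in> carrier (tensor_power R A (Suc n))"
    if "s \<in> ?P" for s
  proof (rule pure_tensor_closed[OF module_axioms entrywise_linear_tuples[OF _ xs]])
    show "entrywise_linear R A (Suc n) A (Suc n) (permute_list s)"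
      by (rule entrywise_linear_permute_list[OF module_axioms permutes_subset]) (use that in auto)
  qed
  have bij: "bij_betw Hilbert_Choice.inv ?P ?P"
    by (rule bij_betw_byWitness[where f' = Hilbert_Choice.inv])
      (auto simp: permutes_inv_inv permutes_inv)
  have "antisymmetrization R A n (pure_tensor R A xs) =
      (\<Oplus>\<^bsub>tensor_power R A (Suc n)\<^esub>\<sigma>\<in>?P.
        [(sign \<sigma>)] \<cdot>\<^bsub>tensor_power R A (Suc n)\<^esub> pure_tensor R A (antisym_term n \<sigma> xs))"
    unfolding antisymmetrization_eq
    by (rule tensor_lift_signed_sum[OF module_axioms _ entrywise_linear_antisym_term])
      (simp_all add: finite_permutations xs)
  also have "\<dots> = (\<Oplus>\<^bsub>tensor_power R A (Suc n)\<^esub>\<sigma>\<in>?P. [(sign (Hilbert_Choice.inv \<sigma>))]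
      \<cdot>\<^bsub>tensor_power R A (Suc n)\<^esub> pure_tensor R A (permute_list (Hilbert_Choice.inv \<sigma>) xs))"
  proof (rule T.M.finsum_cong')
    fix \<sigma> assume \<sigma>: "\<sigma> \<in> ?P"
    then have "antisym_term n \<sigma> xs = permute_list (Hilbert_Choice.inv \<sigma>) xs"
      using antisym_term_eq[OF xs] by simp
    moreover have "sign (Hilbert_Choice.inv \<sigma>) = sign \<sigma>"
      using \<sigma> permutes_imp_permutation[of "{1..n}" \<sigma>] by (simp add: sign_inverse)
    ultimately show "[(sign \<sigma>)] \<cdot>\<^bsub>tensor_power R A (Suc n)\<^esub> pure_tensor R A (antisym_term n \<sigma> xs) =
        [(sign (Hilbert_Choice.inv \<sigma>))] \<cdot>\<^bsub>tensor_power R A (Suc n)\<^esub>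
          pure_tensor R A (permute_list (Hilbert_Choice.inv \<sigma>) xs)" by simp
  qed (use clo permutes_inv in auto)
  also have "\<dots> = (\<Oplus>\<^bsub>tensor_power R A (Suc n)\<^esub>s\<in>?P.
      [(sign s)] \<cdot>\<^bsub>tensor_power R A (Suc n)\<^esub> pure_tensor R A (permute_list s xs))"
    by (rule T.M.finsum_reindex_bij_betw[OF bij]) (use clo in auto)
  finally show ?thesis .
qed

text \<open>
  On a pure tensor both composites are sums of merged tensors, to which the summation identity
  applies.
\<close>

lemma antisymmetrization_chain_map:
  assumes X: "X \<in> carrier (tensor_power R A (Suc (Suc n)))"
  shows "hochschild_diff R A n (antisymmetrization R A (Suc n) X) =
    antisymmetrization R A n (leibniz_diff R A (Suc n) X)"
proof -
  let ?T = "tensor_power R A (Suc n)"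
  have lin: "linear_map R (tensor_power R A (Suc (Suc n))) ?T
      (\<lambda>X. hochschild_diff R A n (antisymmetrization R A (Suc n) X))"
    by (rule linear_map_compose[OF antisymmetrization_linear hochschild_diff_facts(1)])
  have lin': "linear_map R (tensor_power R A (Suc (Suc n))) ?T
      (\<lambda>X. antisymmetrization R A n (leibniz_diff R A (Suc n) X))"
    by (rule linear_map_compose[OF leibniz_diff_facts(1) antisymmetrization_linear])
  show ?thesis
  proof (rule linear_map_eqI_pure_tensor[OF module_axioms lin lin' _ X])
    fix xs assume xs: "xs \<in> tuples A (Suc (Suc n))"
    interpret merged_tensors R A ?T n "Suc n" "pure_tensor R A" xs
      by (intro merged_tensors.intro merged_tensors_axioms.intro assoc_algebra_axioms
          module_tensor_power[OF module_axioms] multilinear_pure_tensor[OF module_axioms] xs refl)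
    have Perms: "{s. s permutes {1..Suc n}} = Perms" by (simp add: Perms_def)
    have perm: "permute_list s xs \<in> tuples A (Suc (Suc n))" if "s \<in> Perms" for s
      by (rule entrywise_linear_tuples[OF entrywise_linear_permute_list[OF module_axioms PermsD(1)[OF that]] xs])
    have "hochschild_diff R A n (antisymmetrization R A (Suc n) (pure_tensor R A xs)) =
        (\<Oplus>\<^bsub>?T\<^esub>s\<in>Perms. [(sign s)] \<cdot>\<^bsub>?T\<^esub> hochschild_diff R A n (pure_tensor R A (permute_list s xs)))"
      unfolding antisymmetrization_pure[OF xs] Perms
      by (rule linear_map_signed_sum[OF hochschild_diff_facts(1) finite_Perms])
        (use perm pure_tensor_closed[OF module_axioms] in blast)
    also have "\<dots> = (\<Oplus>\<^bsub>?T\<^esub>s\<in>Perms. [(sign s)] \<cdot>\<^bsub>?T\<^esub> (\<Oplus>\<^bsub>?T\<^esub>i\<in>{0..Suc n}.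
        [((-1 :: int) ^ i)] \<cdot>\<^bsub>?T\<^esub> pure_tensor R A (hochschild_face A (Suc n) i (permute_list s xs))))"
    proof (rule T.M.finsum_cong')
      fix s assume s: "s \<in> Perms"
      show "[(sign s)] \<cdot>\<^bsub>?T\<^esub> hochschild_diff R A n (pure_tensor R A (permute_list s xs)) =
          [(sign s)] \<cdot>\<^bsub>?T\<^esub> (\<Oplus>\<^bsub>?T\<^esub>i\<in>{0..Suc n}. [((-1 :: int) ^ i)] \<cdot>\<^bsub>?T\<^esub>
            pure_tensor R A (hochschild_face A (Suc n) i (permute_list s xs)))"
        by (simp only: hochschild_diff_facts(2)[OF perm[OF s]])
    next
      have "pure_tensor R A (hochschild_face A (Suc n) i (permute_list s xs)) \<in> carrier ?T"
        if "s \<in> Perms" "i \<in> {0..Suc n}" for s i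
        using pure_tensor_closed[OF module_axioms entrywise_linear_tuples[OF entrywise_linear_hochschild_face
            perm[OF that(1)]]] that(2) by simp
      then show "(\<lambda>s. [(sign s)] \<cdot>\<^bsub>?T\<^esub> (\<Oplus>\<^bsub>?T\<^esub>i\<in>{0..Suc n}. [((-1 :: int) ^ i)] \<cdot>\<^bsub>?T\<^esub>
            pure_tensor R A (hochschild_face A (Suc n) i (permute_list s xs)))) \<in> Perms \<rightarrow> carrier ?T"
        by (intro funcsetI T.sign_smult_closed T.M.finsum_closed) blast
    qed simp
    also have "\<dots> = (\<Oplus>\<^bsub>?T\<^esub>z\<in>Increasing. merged (commutator A) z)"
      unfolding sum_hochschild sum_commutators ..
    also have "\<dots> = (\<Oplus>\<^bsub>?T\<^esub>p\<in>{(i, j). i < j \<and> j \<le> Suc n}. [((-1 :: int) ^ (snd p + 1))] \<cdot>\<^bsub>?T\<^esub>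
        antisymmetrization R A n (pure_tensor R A (leibniz_term A p xs)))"
      unfolding sum_leibniz[symmetric]
    proof (rule T.M.finsum_cong')
      fix p assume p: "p \<in> {(i, j). i < j \<and> j \<le> Suc n}"
      note tup = entrywise_linear_tuples[OF entrywise_linear_leibniz_term[OF p] xs]
      have "leibniz_term A p xs =
          absorb_last (commutator A) (fst p) (permute_list (move_to_end (Suc n) (snd p)) xs)"
        using p xs leibniz_term_eq[of xs "Suc n" "fst p" "snd p" "commutator A"]
        by (auto simp: leibniz_term_def tuples_def)
      then show "[((-1 :: int) ^ (snd p + 1))] \<cdot>\<^bsub>?T\<^esub> (\<Oplus>\<^bsub>?T\<^esub>t\<in>{t. t permutes {1..n}}. [(sign t)] \<cdot>\<^bsub>?T\<^esub>
            pure_tensor R A (permute_list t (absorb_last (commutator A) (fst p)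
              (permute_list (move_to_end (Suc n) (snd p)) xs)))) =
          [((-1 :: int) ^ (snd p + 1))] \<cdot>\<^bsub>?T\<^esub>
            antisymmetrization R A n (pure_tensor R A (leibniz_term A p xs))"
        using antisymmetrization_pure[OF tup] by simp
    next
      show "(\<lambda>p. [((-1 :: int) ^ (snd p + 1))] \<cdot>\<^bsub>?T\<^esub>
          antisymmetrization R A n (pure_tensor R A (leibniz_term A p xs)))
          \<in> {(i, j). i < j \<and> j \<le> Suc n} \<rightarrow> carrier ?T"
        using linear_map_closed[OF antisymmetrization_linear pure_tensor_closed[OF module_axioms
            entrywise_linear_tuples[OF entrywise_linear_leibniz_term xs]]] by (intro funcsetI T.sign_smult_closed)
    qed simp
    also have "\<dots> = antisymmetrization R A n (leibniz_diff R A (Suc n) (pure_tensor R A xs))"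
      unfolding leibniz_diff_facts(2)[OF xs]
      by (rule linear_map_signed_sum[OF antisymmetrization_linear finite_pairs, symmetric])
        (use pure_tensor_closed[OF module_axioms entrywise_linear_tuples[OF entrywise_linear_leibniz_term xs]]
          in blast)
    finally show "hochschild_diff R A n (antisymmetrization R A (Suc n) (pure_tensor R A xs)) =
        antisymmetrization R A n (leibniz_diff R A (Suc n) (pure_tensor R A xs))" .
  qed
qed

end

lemma differentials_leibniz: "assoc_algebra R A \<Longrightarrow> differentials R (leibniz_chain R A) (leibniz_diff R A)"
  by (rule differentials.intro) (simp add: leibniz_chain_def assoc_algebra.leibniz_diff_facts(1))

lemma differentials_hochschild: "assoc_algebra R A \<Longrightarrow> differentials R (hochschild_chain R A) (hochschild_diff R A)"
  by (rule differentials.intro) (simp add: hochschild_chain_def assoc_algebra.hochschild_diff_facts(1))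

lemma homology_morphism_antisymmetrization:
  assumes A: "assoc_algebra R A"
  shows "homology_morphism R (leibniz_chain R A) (leibniz_diff R A) (hochschild_chain R A)
    (hochschild_diff R A) (Suc n) n (antisymmetrization R A n)"
proof (intro homology_morphism.intro differentials_leibniz differentials_hochschild A homology_morphism_axioms.intro)
  interpret assoc_algebra R A by (rule A)
  show "linear_map R (leibniz_chain R A (Suc n)) (hochschild_chain R A n) (antisymmetrization R A n)"
    using antisymmetrization_linear by (simp add: leibniz_chain_def hochschild_chain_def)
  show "antisymmetrization R A n z \<in> cycles (hochschild_chain R A) (hochschild_diff R A) n"
    if "z \<in> cycles (leibniz_chain R A) (leibniz_diff R A) (Suc n)" for z
  proof -
    have z: "z \<in> carrier (tensor_power R A (Suc n))" "leibniz_diff R A n z = \<zero>\<^bsub>tensor_power R A n\<^esub>"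
      using that by (auto simp: cycles_def leibniz_chain_def)
    note closed = linear_map_closed[OF antisymmetrization_linear z(1)]
    show ?thesis
    proof (cases n)
      case 0
      then show ?thesis using closed by (simp add: cycles_def hochschild_chain_def)
    next
      case (Suc m)
      then have "hochschild_diff R A m (antisymmetrization R A n z) = \<zero>\<^bsub>tensor_power R A (Suc m)\<^esub>"
        using antisymmetrization_chain_map[of z m] z linear_map_facts(2)[OF antisymmetrization_linear, of m]
        by simp
      then show ?thesis using closed by (simp add: cycles_def hochschild_chain_def Suc)
    qed
  qed
  show "\<exists>y\<in>carrier (hochschild_chain R A (Suc n)).
      antisymmetrization R A n (leibniz_diff R A (Suc n) x) = hochschild_diff R A n y"
    if "x \<in> carrier (leibniz_chain R A (Suc (Suc n)))" for x
    using that antisymmetrization_chain_map[of x n] linear_map_closed[OF antisymmetrization_linear]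
    by (intro bexI[of _ "antisymmetrization R A (Suc n) x"])
      (simp_all add: leibniz_chain_def hochschild_chain_def)
qed

section \<open>Naturality in the algebra\<close>

lemma algebra_hom_linear: "algebra_hom R A B f \<Longrightarrow> linear_map R A B f"
  by (simp add: algebra_hom_def)

lemma algebra_hom_mult:
  "algebra_hom R A B f \<Longrightarrow> x \<in> carrier A \<Longrightarrow> y \<in> carrier A \<Longrightarrow> f (x \<otimes>\<^bsub>A\<^esub> y) = f x \<otimes>\<^bsub>B\<^esub> f y"
  by (simp add: algebra_hom_def)

lemma algebra_hom_commutator:
  assumes A: "assoc_algebra R A" and f: "algebra_hom R A B f" and x: "x \<in> carrier A" "y \<in> carrier A"
  shows "f (commutator A x y) = commutator B (f x) (f y)"
  using linear_map_facts(3)[OF algebra_hom_linear[OF f]] x assoc_algebra.alg_mult_closed[OF A]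
  by (simp add: commutator_def algebra_hom_mult[OF f])

lemma leibniz_term_map:
  assumes A: "assoc_algebra R A" and f: "algebra_hom R A B f"
    and p: "p \<in> {(i, j). i < j \<and> j \<le> n}" and xs: "xs \<in> tuples A (Suc n)"
  shows "leibniz_term B p (map f xs) = map f (leibniz_term A p xs)"
proof -
  obtain i j where ij: "p = (i, j)" "i < j" "j \<le> n" using p by auto
  then have "xs ! i \<in> carrier A" "xs ! j \<in> carrier A" "i < length xs" "j < length xs"
    using xs by (auto simp: tuples_def subset_iff)
  then have "(map f xs)[i := commutator B (map f xs ! i) (map f xs ! j)] =
      map f (xs[i := commutator A (xs ! i) (xs ! j)])"
    by (simp add: map_update algebra_hom_commutator[OF A f])
  then show ?thesis
    by (simp only: ij(1) leibniz_term_def prod.case take_map drop_map map_append)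
qed

lemma hochschild_face_map:
  assumes f: "algebra_hom R A B f" and i: "i \<le> Suc n" and xs: "xs \<in> tuples A (Suc (Suc n))"
  shows "hochschild_face B (Suc n) i (map f xs) = map f (hochschild_face A (Suc n) i xs)"
  using i xs algebra_hom_mult[OF f]
  by (auto simp: hochschild_face_def tuples_def take_map drop_map subset_iff)

lemma antisym_term_map:
  assumes f: "linear_map R A B f" and \<sigma>: "\<sigma> permutes {1..n}" and xs: "xs \<in> tuples A (Suc n)"
  shows "antisym_term n \<sigma> (map f xs) = map f (antisym_term n \<sigma> xs)"
proof -
  have "Hilbert_Choice.inv \<sigma> permutes {..<length xs}"
    by (rule permutes_subset[OF permutes_inv[OF \<sigma>]]) (use xs in \<open>auto simp: tuples_def\<close>)
  then show ?thesis
    using antisym_term_eq[OF xs \<sigma>] antisym_term_eq[OF entrywise_linear_tuples[OF entrywise_linear_map[OF f] xs] \<sigma>]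
    by (simp add: permute_list_map)
qed

lemma tensor_power_map_leibniz_diff:
  assumes A: "assoc_algebra R A" and B: "assoc_algebra R B" and f: "algebra_hom R A B f"
    and X: "X \<in> carrier (tensor_power R A (Suc n))"
  shows "tensor_power_map R A B f n (leibniz_diff R A n X) =
    leibniz_diff R B n (tensor_power_map R A B f (Suc n) X)"
  unfolding leibniz_diff_eq
  by (rule tensor_lift_signed_sum_natural[OF algebra_hom_linear[OF f] finite_pairs _ _ _ X])
    (use A B in \<open>auto intro: assoc_algebra.entrywise_linear_leibniz_term leibniz_term_map[OF A f]\<close>)

lemma tensor_power_map_hochschild_diff:
  assumes A: "assoc_algebra R A" and B: "assoc_algebra R B" and f: "algebra_hom R A B f"
    and X: "X \<in> carrier (tensor_power R A (Suc (Suc n)))"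
  shows "tensor_power_map R A B f (Suc n) (hochschild_diff R A n X) =
    hochschild_diff R B n (tensor_power_map R A B f (Suc (Suc n)) X)"
  unfolding hochschild_diff_def
  by (rule tensor_lift_signed_sum_natural[OF algebra_hom_linear[OF f] _ _ _ _ X])
    (use A B in \<open>auto intro: assoc_algebra.entrywise_linear_hochschild_face hochschild_face_map[OF f]\<close>)

lemma tensor_power_map_antisymmetrization:
  assumes A: "assoc_algebra R A" and B: "assoc_algebra R B" and f: "algebra_hom R A B f"
    and X: "X \<in> carrier (tensor_power R A (Suc n))"
  shows "tensor_power_map R A B f (Suc n) (antisymmetrization R A n X) =
    antisymmetrization R B n (tensor_power_map R A B f (Suc n) X)"
  unfolding antisymmetrization_eq
  by (rule tensor_lift_signed_sum_natural[OF algebra_hom_linear[OF f] _ _ _ _ X])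
    (use A B in \<open>auto simp: finite_permutations intro: assoc_algebra.entrywise_linear_antisym_term antisym_term_map[OF algebra_hom_linear[OF f]]\<close>)

lemma homology_morphism_leibniz:
  assumes A: "assoc_algebra R A" and B: "assoc_algebra R B" and f: "algebra_hom R A B f"
  shows "homology_morphism R (leibniz_chain R A) (leibniz_diff R A) (leibniz_chain R B)
    (leibniz_diff R B) n n (tensor_power_map R A B f n)"
proof (intro homology_morphism.intro differentials_leibniz A B homology_morphism_axioms.intro)
  note F = tensor_power_map_facts(1)[OF algebra_hom_linear[OF f]]
  note comm = tensor_power_map_leibniz_diff[OF A B f]
  show "linear_map R (leibniz_chain R A n) (leibniz_chain R B n) (tensor_power_map R A B f n)"
    using F by (simp add: leibniz_chain_def)
  show "tensor_power_map R A B f n z \<in> cycles (leibniz_chain R B) (leibniz_diff R B) n"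
    if "z \<in> cycles (leibniz_chain R A) (leibniz_diff R A) n" for z
    using that linear_map_closed[OF F] linear_map_facts(2)[OF F] comm[symmetric]
    by (auto simp: cycles_def leibniz_chain_def split: nat.splits)
  show "\<exists>y\<in>carrier (leibniz_chain R B (Suc n)).
      tensor_power_map R A B f n (leibniz_diff R A n x) = leibniz_diff R B n y"
    if "x \<in> carrier (leibniz_chain R A (Suc n))" for x
    using that linear_map_closed[OF F] comm unfolding leibniz_chain_def by blast
qed

lemma homology_morphism_hochschild:
  assumes A: "assoc_algebra R A" and B: "assoc_algebra R B" and f: "algebra_hom R A B f"
  shows "homology_morphism R (hochschild_chain R A) (hochschild_diff R A) (hochschild_chain R B)
    (hochschild_diff R B) n n (tensor_power_map R A B f (Suc n))"
proof (intro homology_morphism.intro differentials_hochschild A B homology_morphism_axioms.intro)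
  note F = tensor_power_map_facts(1)[OF algebra_hom_linear[OF f]]
  note comm = tensor_power_map_hochschild_diff[OF A B f]
  show "linear_map R (hochschild_chain R A n) (hochschild_chain R B n) (tensor_power_map R A B f (Suc n))"
    using F by (simp add: hochschild_chain_def)
  show "tensor_power_map R A B f (Suc n) z \<in> cycles (hochschild_chain R B) (hochschild_diff R B) n"
    if "z \<in> cycles (hochschild_chain R A) (hochschild_diff R A) n" for z
    using that linear_map_closed[OF F] linear_map_facts(2)[OF F] comm[symmetric]
    by (auto simp: cycles_def hochschild_chain_def split: nat.splits)
  show "\<exists>y\<in>carrier (hochschild_chain R B (Suc n)).
      tensor_power_map R A B f (Suc n) (hochschild_diff R A n x) = hochschild_diff R B n y"
    if "x \<in> carrier (hochschild_chain R A (Suc n))" for x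
    using that linear_map_closed[OF F] comm unfolding hochschild_chain_def by blast
qed

theorem corollary2p2:
  fixes k :: "('k, 'r) ring_scheme"
    and A :: "('k, 'a, 'm) module_scheme"
  assumes "cring k"
    and "assoc_algebra k A"
  shows
    "(\<forall>n. linear_map k (leibniz_chain k A (Suc n)) (hochschild_chain k A n) (antisymmetrization k A n)) \<and>
     (\<forall>n. \<forall>x\<in>carrier (leibniz_chain k A (Suc (Suc n))).
        hochschild_diff k A n (antisymmetrization k A (Suc n) x) = antisymmetrization k A n (leibniz_diff k A (Suc n) x)) \<and>
     (\<forall>n. linear_map k (leibniz_homology k A (Suc n)) (hochschild_homology k A n)
        (antisym_homology k A n)) \<and>
     (\<forall>n. \<forall>z\<in>cycles (leibniz_chain k A) (leibniz_diff k A) (Suc n).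
        antisymmetrization k A n z \<in> cycles (hochschild_chain k A) (hochschild_diff k A) n \<and>
        antisym_homology k A n (homology_class (leibniz_chain k A) (leibniz_diff k A) (Suc n) z) =
          homology_class (hochschild_chain k A) (hochschild_diff k A) n (antisymmetrization k A n z)) \<and>
     (\<forall>(B :: ('k, 'b, 'n) module_scheme) f. assoc_algebra k B \<longrightarrow> algebra_hom k A B f \<longrightarrow>
        (\<forall>n. \<forall>X\<in>carrier (leibniz_homology k A (Suc n)).
           hochschild_homology_map k A B f n (antisym_homology k A n X) =
           antisym_homology k B n (leibniz_homology_map k A B f (Suc n) X)))"
proof (intro conjI allI ballI impI)
  note morphism = homology_morphism_antisymmetrization[OF assms(2)]
  note linear = homology_morphism.linear[OF morphism]
  note cycles = homology_morphism.cycles[OF morphism]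
  note cycles_carrier = differentials.cycles_carrier[OF differentials_leibniz[OF assms(2)]]
  show "linear_map k (leibniz_chain k A (Suc n)) (hochschild_chain k A n) (antisymmetrization k A n)" for n
    by (rule linear)
  show "hochschild_diff k A n (antisymmetrization k A (Suc n) x) = antisymmetrization k A n (leibniz_diff k A (Suc n) x)"
    if "x \<in> carrier (leibniz_chain k A (Suc (Suc n)))" for n x
    using assoc_algebra.antisymmetrization_chain_map[OF assms(2)] that by (simp add: leibniz_chain_def)
  show "linear_map k (leibniz_homology k A (Suc n)) (hochschild_homology k A n) (antisym_homology k A n)" for n
    unfolding leibniz_homology_def hochschild_homology_def antisym_homology_def
    by (rule homology_morphism.homology_map_linear[OF morphism])
  show "antisymmetrization k A n z \<in> cycles (hochschild_chain k A) (hochschild_diff k A) n"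
    if "z \<in> cycles (leibniz_chain k A) (leibniz_diff k A) (Suc n)" for n z
    by (rule cycles[OF that])
  have class_eq: "antisym_homology k A n (homology_class (leibniz_chain k A) (leibniz_diff k A) (Suc n) z) =
      homology_class (hochschild_chain k A) (hochschild_diff k A) n (antisymmetrization k A n z)"
    if "z \<in> cycles (leibniz_chain k A) (leibniz_diff k A) (Suc n)" for n z
    unfolding antisym_homology_def
    by (rule homology_morphism.homology_map_class[OF morphism cycles_carrier[OF that]])
  show "antisym_homology k A n (homology_class (leibniz_chain k A) (leibniz_diff k A) (Suc n) z) =
      homology_class (hochschild_chain k A) (hochschild_diff k A) n (antisymmetrization k A n z)"
    if "z \<in> cycles (leibniz_chain k A) (leibniz_diff k A) (Suc n)" for n z
    by (rule class_eq[OF that])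
  fix B :: "('k, 'b, 'n) module_scheme" and f n X
  assume B: "assoc_algebra k B" and f: "algebra_hom k A B f"
    and "X \<in> carrier (leibniz_homology k A (Suc n))"
  then obtain z where z: "z \<in> cycles (leibniz_chain k A) (leibniz_diff k A) (Suc n)"
    and X: "X = homology_class (leibniz_chain k A) (leibniz_diff k A) (Suc n) z"
    using differentials.carrier_homology[OF differentials_leibniz[OF assms(2)], of "Suc n"]
    unfolding leibniz_homology_def by blast
  note zc = cycles_carrier[OF z]
  note L = homology_morphism_leibniz[OF assms(2) B f]
  note H = homology_morphism_hochschild[OF assms(2) B f]
  have "hochschild_homology_map k A B f n (antisym_homology k A n X) =
      homology_class (hochschild_chain k B) (hochschild_diff k B) n
        (tensor_power_map k A B f (Suc n) (antisymmetrization k A n z))"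
    unfolding X class_eq[OF z] hochschild_homology_map_def
    by (rule homology_morphism.homology_map_class[OF H linear_map_closed[OF linear zc]])
  also have "\<dots> = homology_class (hochschild_chain k B) (hochschild_diff k B) n
      (antisymmetrization k B n (tensor_power_map k A B f (Suc n) z))"
    using tensor_power_map_antisymmetrization[OF assms(2) B f, of z n] zc
    by (simp add: leibniz_chain_def)
  also have "\<dots> = antisym_homology k B n (homology_class (leibniz_chain k B) (leibniz_diff k B) (Suc n)
      (tensor_power_map k A B f (Suc n) z))"
    unfolding antisym_homology_def
    by (rule homology_morphism.homology_map_class[OF homology_morphism_antisymmetrization[OF B]
          linear_map_closed[OF homology_morphism.linear[OF L] zc], symmetric])
  also have "\<dots> = antisym_homology k B n (leibniz_homology_map k A B f (Suc n) X)"
    unfolding X leibniz_homology_map_def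
    by (simp add: homology_morphism.homology_map_class[OF L zc])
  finally show "hochschild_homology_map k A B f n (antisym_homology k A n X) =
      antisym_homology k B n (leibniz_homology_map k A B f (Suc n) X)" .
qed

end
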